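(* The language $\mathfrak{W}$ is context-sensitive but not context-free. Deciding whether a given word belongs to $\mathfrak{W}$ can be done in $O(n^2)$ time and $O(n)$ space, where $n$ is the length of the word.
   Context: Fix disjoint sets $\mathbb{R}$ (requests $a,b,\dots$) and $\mathbb{O}$ (offers $\overline a,\overline b,\dots$) and an idle symbol $\Box$; $\Sigma=\mathbb{R}\cup\mathbb{O}\cup\{\Box\}$, $co$ swaps $a$ and $\overline a$ and fixes $\Box$. For $\vec v\in\Sigma^n$, $\Box^k$ denotes the vector of $k$ idle symbols. $\vec a\in\Sigma^n$ is a request (resp. offer) on $\alpha$ if $\vec a=\Box^{n_1}\alpha\Box^{n_2}$ with $\alpha\in\mathbb{R}$ (resp. $\mathbb{O}$). Two vectors are complementary, $\vec a\bowtie\vec b$, iff $\vec a$ is a request or an offer on some $\alpha$, and if $\vec a$ is an offer on $\alpha$ then $\vec b$ is a request on $co(\alpha)$, and if $\vec a$ is a request on $\alpha$ then $\vec b$ is an offer on $co(\alpha)$. $\mathfrak{W}$ is the set of words $w=\vec a_1\ldots\vec a_m\in(\Sigma^n)^*$ with $n>1$ for which there exists a function $f:[1..m]\to[1..m]$, total and injective on the indices of the request actions of $w$, such that $f(i)=j$ only if $\vec a_i\bowtie\vec a_j$.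
   Formalization: The set of requests is assumed finite, so that the alphabet is finite and the grammar notions make sense, and to contain at least two requests; with a single request the language is context-free, so the claim as stated would fail. *)

theory Defs
  imports Complex_Main "HOL-Library.Landau_Symbols"
begin

section \<open>Contract actions and the language of weak agreement\<close>

text \<open>
  Requests and offers are tagged copies of a set \<open>R\<close> of names, so that they are disjoint by
  construction: \<open>Req a\<close> is the request on \<open>a\<close>, \<open>Off a\<close> the matching offer (written with
  an overline on paper), and \<open>Idle\<close> is the idle symbol.
\<close>

datatype 'a action = Req 'a | Off 'a | Idle

fun co :: "'a action \<Rightarrow> 'a action" where
  "co (Req a) = Off a"
| "co (Off a) = Req a"
| "co Idle = Idle"

definition actions :: "'a set \<Rightarrow> 'a action set" where
  "actions R = Req ` R \<union> Off ` R \<union> {Idle}"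

text \<open>The set of vectors of rank \<open>n\<close>; it is the alphabet of the language below.\<close>

definition vectors :: "'a set \<Rightarrow> nat \<Rightarrow> 'a action list set" where
  "vectors R n = {v. length v = n \<and> set v \<subseteq> actions R}"

definition request_on :: "'a action list \<Rightarrow> 'a action \<Rightarrow> bool" where
  "request_on v \<alpha> \<longleftrightarrow> \<alpha> \<in> range Req \<and>
     (\<exists>n1 n2. v = replicate n1 Idle @ [\<alpha>] @ replicate n2 Idle)"

definition offer_on :: "'a action list \<Rightarrow> 'a action \<Rightarrow> bool" where
  "offer_on v \<alpha> \<longleftrightarrow> \<alpha> \<in> range Off \<and>
     (\<exists>n1 n2. v = replicate n1 Idle @ [\<alpha>] @ replicate n2 Idle)"

definition complementary :: "'a action list \<Rightarrow> 'a action list \<Rightarrow> bool" (infix "\<bowtie>" 50) where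
  "v \<bowtie> u \<longleftrightarrow>
     (\<exists>\<alpha>. request_on v \<alpha> \<or> offer_on v \<alpha>) \<and>
     (\<forall>\<alpha>. offer_on v \<alpha> \<longrightarrow> request_on u (co \<alpha>)) \<and>
     (\<forall>\<alpha>. request_on v \<alpha> \<longrightarrow> offer_on u (co \<alpha>))"

definition request_indices :: "'a action list list \<Rightarrow> nat set" where
  "request_indices w = {i. i < length w \<and> (\<exists>\<alpha>. request_on (w ! i) \<alpha>)}"

text \<open>
  The function \<open>f\<close> is partial on the positions of \<open>w\<close> (counted from 0); totality and
  injectivity are only required on the positions of requests.
\<close>

definition weak_agreement :: "'a set \<Rightarrow> nat \<Rightarrow> 'a action list list set" where
  "weak_agreement R n = {w \<in> lists (vectors R n).
     \<exists>f :: nat \<rightharpoonup> nat. dom f \<subseteq> {..<length w} \<and> ran f \<subseteq> {..<length w} \<and>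
       request_indices w \<subseteq> dom f \<and> inj_on f (request_indices w) \<and>
       (\<forall>i j. f i = Some j \<longrightarrow> w ! i \<bowtie> w ! j)}"


section \<open>Chomsky grammars\<close>

text \<open>
  Finitely many productions mention only finitely many nonterminals, so naming the nonterminals
  by natural numbers is no restriction.
\<close>

datatype 't gsym = NT nat | Tm 't

record 't grammar =
  start :: nat
  prods :: "('t gsym list \<times> 't gsym list) set"

definition derives1 :: "'t grammar \<Rightarrow> 't gsym list \<Rightarrow> 't gsym list \<Rightarrow> bool" where
  "derives1 G x y \<longleftrightarrow> (\<exists>u v l r. (l, r) \<in> prods G \<and> x = u @ l @ v \<and> y = u @ r @ v)"

definition generated_language :: "'t grammar \<Rightarrow> 't list set" where
  "generated_language G = {w. (derives1 G)\<^sup>*\<^sup>* [NT (start G)] (map Tm w)}"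

definition context_free_grammar :: "'t grammar \<Rightarrow> bool" where
  "context_free_grammar G \<longleftrightarrow> finite (prods G) \<and> (\<forall>(l, r) \<in> prods G. \<exists>A. l = [NT A])"

text \<open>
  As usual, the empty word may be produced, by the start symbol only, provided that the start
  symbol occurs in no right-hand side.
\<close>

definition context_sensitive_grammar :: "'t grammar \<Rightarrow> bool" where
  "context_sensitive_grammar G \<longleftrightarrow> finite (prods G) \<and>
     (\<forall>(l, r) \<in> prods G.
        (\<exists>\<beta> A \<delta> \<gamma>. l = \<beta> @ [NT A] @ \<delta> \<and> r = \<beta> @ \<gamma> @ \<delta> \<and> \<gamma> \<noteq> []) \<or>
        (l = [NT (start G)] \<and> r = [] \<and> (\<forall>(l', r') \<in> prods G. NT (start G) \<notin> set r')))"

definition context_free_language :: "'t list set \<Rightarrow> bool" where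
  "context_free_language L \<longleftrightarrow> (\<exists>G. context_free_grammar G \<and> generated_language G = L)"

definition context_sensitive_language :: "'t list set \<Rightarrow> bool" where
  "context_sensitive_language L \<longleftrightarrow> (\<exists>G. context_sensitive_grammar G \<and> generated_language G = L)"


section \<open>Deterministic single-tape Turing machines\<close>

text \<open>
  The tape is infinite in both directions. Besides the blank and the input letters a machine may
  use finitely many work symbols; states and work symbols are named by natural numbers, which is
  again no restriction.
\<close>

datatype 't tape_sym = Blank | Input 't | Work nat

datatype dir = Left | Stay | Right

record 't tm =
  states :: "nat set"
  tape_alphabet :: "'t tape_sym set"
  delta :: "nat \<Rightarrow> 't tape_sym \<Rightarrow> nat \<times> 't tape_sym \<times> dir"
  initial :: nat
  accepting :: nat
  rejecting :: nat

definition turing_machine :: "'t set \<Rightarrow> 't tm \<Rightarrow> bool" where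
  "turing_machine A M \<longleftrightarrow>
     finite (states M) \<and> finite (tape_alphabet M) \<and>
     insert Blank (Input ` A) \<subseteq> tape_alphabet M \<and>
     {initial M, accepting M, rejecting M} \<subseteq> states M \<and> accepting M \<noteq> rejecting M \<and>
     (\<forall>q \<in> states M. \<forall>x \<in> tape_alphabet M.
        delta M q x \<in> states M \<times> tape_alphabet M \<times> UNIV)"

record 't config =
  state :: nat
  head :: int
  tape :: "int \<Rightarrow> 't tape_sym"

fun move :: "dir \<Rightarrow> int \<Rightarrow> int" where
  "move Left h = h - 1"
| "move Stay h = h"
| "move Right h = h + 1"

definition halted :: "'t tm \<Rightarrow> 't config \<Rightarrow> bool" where
  "halted M c \<longleftrightarrow> state c \<in> {accepting M, rejecting M}"

definition tm_step :: "'t tm \<Rightarrow> 't config \<Rightarrow> 't config" where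
  "tm_step M c =
     (if halted M c then c
      else case delta M (state c) (tape c (head c)) of (q, x, d) \<Rightarrow>
        \<lparr>state = q, head = move d (head c), tape = (tape c)(head c := x)\<rparr>)"

definition initial_config :: "'t tm \<Rightarrow> 't list \<Rightarrow> 't config" where
  "initial_config M w =
     \<lparr>state = initial M, head = 0,
      tape = (\<lambda>p. if 0 \<le> p \<and> p < int (length w) then Input (w ! nat p) else Blank)\<rparr>"

definition tm_run :: "'t tm \<Rightarrow> 't list \<Rightarrow> nat \<Rightarrow> 't config" where
  "tm_run M w i = (tm_step M ^^ i) (initial_config M w)"

text \<open>
  \<open>M\<close> decides the language \<open>L\<close> over the alphabet \<open>A\<close>, and on every word of length \<open>k\<close> over
  \<open>A\<close> it halts after at most \<open>T k\<close> steps and visits at most \<open>S k\<close> tape cells, those holding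
  the input included.
\<close>

definition decides_within ::
  "'t set \<Rightarrow> 't tm \<Rightarrow> 't list set \<Rightarrow> (nat \<Rightarrow> nat) \<Rightarrow> (nat \<Rightarrow> nat) \<Rightarrow> bool" where
  "decides_within A M L T S \<longleftrightarrow>
     (\<forall>w \<in> lists A. \<exists>t \<le> T (length w).
        halted M (tm_run M w t) \<and>
        (state (tm_run M w t) = accepting M \<longleftrightarrow> w \<in> L) \<and>
        card ((\<lambda>i. head (tm_run M w i)) ` {..t}) \<le> S (length w))"

end

theory Submission
  imports Defs "HOL-Library.Multiset"
begin

text \<open>
  The positions of letters inside a vector and inside a word are irrelevant: a word is in the
  language iff for every name it has at least as many offers as requests.

  Not context-free: in \<open>ra^p rb^p oa^p ob^p\<close> a window of length \<open>p\<close> cannot meet both the requests and the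
  offers on one name, whereas pumping down and up forces the pumped parts to contain equally many of them.

  Context-sensitive: generate harmless letters, and pairs of a request and a matching offer, at the
  left end, and let the second component of each pair travel to the right.

  Decidable: repeatedly cross off a request and then a matching offer, returning to the left end
  after each. At most \<open>k\<close> letters are crossed off and every sweep costs \<open>O(k)\<close> steps.
\<close>

section \<open>Balanced words\<close>

text \<open>Counting suffices because offers on different names sit at different positions:
  injections chosen separately for each name never collide, so together they form a single function
  \<open>f\<close>. Pumping argument, grammar and machine can then work over an arbitrary alphabet
  \<open>A\<close> with a map \<open>kind\<close>.

  Two names are essential for the failure of context-freeness: with one name the condition merely
  compares two counts, which a pushdown automaton can do. The grammar may grow by one or two letters
  at a time because every nonempty balanced word can give up its first letter, alone or with one
  partner, and stay balanced. Crossing off greedily is safe because all offers on a name are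
  interchangeable, so no choice ever has to be undone.\<close>

definition balanced :: "'a action multiset \<Rightarrow> bool" where
  "balanced M \<longleftrightarrow> (\<forall>a. count M (Req a) \<le> count M (Off a))"

definition balanced_words :: "('t \<Rightarrow> 'a action) \<Rightarrow> 't set \<Rightarrow> 't list set" where
  "balanced_words kind A = {w \<in> lists A. balanced (image_mset kind (mset w))}"

lemma balanced_union: "balanced M \<Longrightarrow> balanced N \<Longrightarrow> balanced (M + N)"
  by (simp add: balanced_def add_mono)

lemma balanced_empty [simp]: "balanced {#}"
  by (simp add: balanced_def)

text \<open>Vectors with several non-idle entries are neither requests nor offers; they share the
  value \<open>Idle\<close> with the idle vector because both are harmless.\<close>

definition kind_of :: "'a action list \<Rightarrow> 'a action" where
  "kind_of v = (case filter (\<lambda>x. x \<noteq> Idle) v of [\<alpha>] \<Rightarrow> \<alpha> | _ \<Rightarrow> Idle)"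

lemma single_nonidle_iff:
  assumes "\<alpha> \<noteq> Idle"
  shows "(\<exists>n1 n2. v = replicate n1 Idle @ [\<alpha>] @ replicate n2 Idle) \<longleftrightarrow>
    filter (\<lambda>x. x \<noteq> Idle) v = [\<alpha>]"
proof
  assume "filter (\<lambda>x. x \<noteq> Idle) v = [\<alpha>]"
  then obtain us vs where v: "v = us @ \<alpha> # vs" and "\<forall>u\<in>set us. u = Idle"
    and "filter (\<lambda>x. x \<noteq> Idle) vs = []"
    by (auto simp: filter_eq_Cons_iff)
  then have "us = replicate (length us) Idle" "vs = replicate (length vs) Idle"
    by (auto simp: filter_empty_conv intro: replicate_eqI)
  with v show "\<exists>n1 n2. v = replicate n1 Idle @ [\<alpha>] @ replicate n2 Idle"
    by (metis append_Cons append_Nil)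
qed (use assms in auto)

lemma kind_of_eq_iff: "\<alpha> \<noteq> Idle \<Longrightarrow> kind_of v = \<alpha> \<longleftrightarrow> filter (\<lambda>x. x \<noteq> Idle) v = [\<alpha>]"
  by (auto simp: kind_of_def split: list.splits)

lemma request_on_iff: "request_on v \<alpha> \<longleftrightarrow> (\<exists>a. \<alpha> = Req a \<and> kind_of v = Req a)"
  unfolding request_on_def using single_nonidle_iff[of \<alpha> v] kind_of_eq_iff[of \<alpha> v] by auto

lemma offer_on_iff: "offer_on v \<alpha> \<longleftrightarrow> (\<exists>a. \<alpha> = Off a \<and> kind_of v = Off a)"
  unfolding offer_on_def using single_nonidle_iff[of \<alpha> v] kind_of_eq_iff[of \<alpha> v] by auto

lemma complementary_iff:
  "v \<bowtie> u \<longleftrightarrow> (\<exists>a. kind_of v = Req a \<and> kind_of u = Off a \<or> kind_of v = Off a \<and> kind_of u = Req a)"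
  unfolding complementary_def request_on_iff offer_on_iff
  by (cases "kind_of v") auto

lemma count_image_mset_nth:
  "count (image_mset f (mset w)) x = card {i. i < length w \<and> f (w ! i) = x}"
proof -
  have "count (image_mset f (mset w)) x = length (filter (\<lambda>v. f v = x) w)"
    by (induction w) auto
  then show ?thesis
    by (simp add: length_filter_conv_card)
qed

text \<open>Complementarity makes \<open>f\<close> send the requests on a name injectively to the
  offers on it. Conversely the injections \<open>g a\<close> are glued: the kind found at the target
  position determines the name, so requests on different names cannot meet. \<open>f\<close> stays
  undefined off the requests, where a partner need not exist.\<close>

lemma weak_agreement_eq: "weak_agreement R n = balanced_words kind_of (vectors R n)"
proof (intro set_eqI iffI)
  fix w assume "w \<in> weak_agreement R n"
  then obtain f :: "nat \<rightharpoonup> nat" where w: "w \<in> lists (vectors R n)"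
    and ran: "ran f \<subseteq> {..<length w}" and dom: "request_indices w \<subseteq> dom f"
    and inj: "inj_on f (request_indices w)"
    and compl: "\<And>i j. f i = Some j \<Longrightarrow> w ! i \<bowtie> w ! j"
    by (auto simp: weak_agreement_def)
  have "count (image_mset kind_of (mset w)) (Req a) \<le> count (image_mset kind_of (mset w)) (Off a)" for a
    unfolding count_image_mset_nth
  proof (rule card_inj_on_le)
    let ?I = "{i. i < length w \<and> kind_of (w ! i) = Req a}"
    let ?J = "{i. i < length w \<and> kind_of (w ! i) = Off a}"
    have sub: "?I \<subseteq> request_indices w"
      by (auto simp: request_indices_def request_on_iff)
    have some: "f i = Some (the (f i))" if "i \<in> ?I" for i
      using sub dom that by auto
    show "inj_on (\<lambda>i. the (f i)) ?I"
      using inj sub some unfolding inj_on_def by (metis (no_types, lifting) subsetD)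
    show "(\<lambda>i. the (f i)) ` ?I \<subseteq> ?J"
    proof
      fix j assume "j \<in> (\<lambda>i. the (f i)) ` ?I"
      then obtain i where i: "i \<in> ?I" "f i = Some j"
        using some by auto
      then show "j \<in> ?J"
        using compl[OF i(2)] ranI[of f i j, OF i(2)] ran by (auto simp: complementary_iff)
    qed
  qed simp
  with w show "w \<in> balanced_words kind_of (vectors R n)"
    by (simp add: balanced_words_def balanced_def)
next
  fix w assume "w \<in> balanced_words kind_of (vectors R n)"
  then have w: "w \<in> lists (vectors R n)"
    and le: "\<And>a. card {i. i < length w \<and> kind_of (w ! i) = Req a}
      \<le> card {i. i < length w \<and> kind_of (w ! i) = Off a}"
    by (auto simp: balanced_words_def balanced_def count_image_mset_nth)
  have "\<exists>g. g ` {i. i < length w \<and> kind_of (w ! i) = Req a}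
      \<subseteq> {i. i < length w \<and> kind_of (w ! i) = Off a} \<and>
      inj_on g {i. i < length w \<and> kind_of (w ! i) = Req a}" for a
    using le[of a] by (intro card_le_inj) auto
  then have "\<forall>a. \<exists>g. g ` {i. i < length w \<and> kind_of (w ! i) = Req a}
      \<subseteq> {i. i < length w \<and> kind_of (w ! i) = Off a} \<and>
      inj_on g {i. i < length w \<and> kind_of (w ! i) = Req a}"
    by blast
  from choice[OF this] obtain g where gs: "\<And>a. g a ` {i. i < length w \<and> kind_of (w ! i) = Req a}
      \<subseteq> {i. i < length w \<and> kind_of (w ! i) = Off a}"
    and inj: "\<And>a. inj_on (g a) {i. i < length w \<and> kind_of (w ! i) = Req a}"
    by blast
  have g: "g a i < length w \<and> kind_of (w ! g a i) = Off a"
    if "i < length w" "kind_of (w ! i) = Req a" for a i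
    using gs[of a] that by blast
  define f where "f i = (if i < length w then
      (case kind_of (w ! i) of Req a \<Rightarrow> Some (g a i) | _ \<Rightarrow> None) else None)" for i
  have fD: "\<exists>a. i < length w \<and> kind_of (w ! i) = Req a \<and> j = g a i" if "f i = Some j" for i j
    using that by (auto simp: f_def split: if_splits action.splits)
  have ind: "request_indices w = {i. i < length w \<and> (\<exists>a. kind_of (w ! i) = Req a)}"
    by (auto simp: request_indices_def request_on_iff)
  have "inj_on f (request_indices w)"
  proof (rule inj_onI)
    fix i j assume ij: "i \<in> request_indices w" "j \<in> request_indices w" "f i = f j"
    then obtain a b where a: "i < length w" "kind_of (w ! i) = Req a"
      and b: "j < length w" "kind_of (w ! j) = Req b"
      by (auto simp: ind)
    with ij have eq: "g a i = g b j"
      by (simp add: f_def)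
    then have "a = b"
      using g[OF a] g[OF b] by simp
    with eq a b inj[of a] show "i = j"
      by (auto simp: inj_on_def)
  qed
  moreover have "dom f \<subseteq> {..<length w}" "ran f \<subseteq> {..<length w}" "request_indices w \<subseteq> dom f"
    using g by (auto simp: ran_def dom_def ind dest!: fD) (auto simp: f_def)
  moreover have "\<forall>i j. f i = Some j \<longrightarrow> w ! i \<bowtie> w ! j"
    using g by (auto simp: complementary_iff dest!: fD)
  ultimately show "w \<in> weak_agreement R n"
    using w unfolding weak_agreement_def by blast
qed

lemma finite_vectors: "finite R \<Longrightarrow> finite (vectors R n)"
proof -
  assume "finite R"
  then have "finite (actions R)"
    by (simp add: actions_def)
  from finite_lists_length_eq[OF this, of n] show ?thesis
    by (rule rev_finite_subset) (auto simp: vectors_def)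
qed


section \<open>Pumping lemma for context-free languages\<close>

lemma derives_context:
  assumes "(derives1 G)\<^sup>*\<^sup>* x y"
  shows "(derives1 G)\<^sup>*\<^sup>* (a @ x @ b) (a @ y @ b)"
  using assms
proof induction
  case (step y z)
  then obtain u v l r where "(l, r) \<in> prods G" "y = u @ l @ v" "z = u @ r @ v"
    by (auto simp: derives1_def)
  then have "derives1 G (a @ y @ b) (a @ z @ b)"
    unfolding derives1_def by (metis append.assoc)
  with step.IH show ?case
    by (rule rtranclp.rtrancl_into_rtrancl)
qed simp

lemma derives_append:
  assumes "(derives1 G)\<^sup>*\<^sup>* x x'" and "(derives1 G)\<^sup>*\<^sup>* y y'"
  shows "(derives1 G)\<^sup>*\<^sup>* (x @ y) (x' @ y')"
  using derives_context[OF assms(1), of "[]" y] derives_context[OF assms(2), of x' "[]"]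
  by simp

lemma derives_production: "(l, r) \<in> prods G \<Longrightarrow> (derives1 G)\<^sup>*\<^sup>* (u @ l @ v) (u @ r @ v)"
  by (rule r_into_rtranclp) (auto simp: derives1_def)

section \<open>Parse trees\<close>

datatype 't ptree = Leaf 't | Node nat "'t ptree list"

fun label :: "'t ptree \<Rightarrow> 't gsym" where
  "label (Leaf a) = Tm a"
| "label (Node A ts) = NT A"

fun yield :: "'t ptree \<Rightarrow> 't list" where
  "yield (Leaf a) = [a]"
| "yield (Node A ts) = concat (map yield ts)"

fun valid :: "'t grammar \<Rightarrow> 't ptree \<Rightarrow> bool" where
  "valid G (Leaf a) \<longleftrightarrow> True"
| "valid G (Node A ts) \<longleftrightarrow> ([NT A], map label ts) \<in> prods G \<and> (\<forall>t \<in> set ts. valid G t)"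

fun nodes :: "'t ptree \<Rightarrow> nat" where
  "nodes (Leaf a) = 1"
| "nodes (Node A ts) = Suc (sum_list (map nodes ts))"

fun height :: "'t ptree \<Rightarrow> nat" where
  "height (Leaf a) = 0"
| "height (Node A ts) = Suc (Max (insert 0 (height ` set ts)))"

text \<open>A path from the root of \<open>t\<close> to a subtree \<open>s\<close>, remembered only
  through the terminal words \<open>u\<close> and \<open>v\<close> to its left and right. These
  words become the pumped factors.\<close>

inductive occurs :: "'t ptree \<Rightarrow> 't ptree \<Rightarrow> 't list \<Rightarrow> 't list \<Rightarrow> bool" where
  refl: "occurs t t [] []"
| child: "occurs t s u v \<Longrightarrow>
    occurs (Node A (ls @ t # rs)) s (concat (map yield ls) @ u) (v @ concat (map yield rs))"

lemma occurs_yield: "occurs t s u v \<Longrightarrow> yield t = u @ yield s @ v"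
  by (induction rule: occurs.induct) auto

lemma occurs_nodes: "occurs t s u v \<Longrightarrow> nodes s \<le> nodes t"
  by (induction rule: occurs.induct) auto

lemma occurs_valid: "occurs t s u v \<Longrightarrow> valid G t \<Longrightarrow> valid G s"
  by (induction rule: occurs.induct) auto

lemma occurs_trans: "occurs t s u v \<Longrightarrow> occurs s r u' v' \<Longrightarrow> occurs t r (u @ u') (v' @ v)"
  by (induction rule: occurs.induct) (use occurs.child in fastforce)+

text \<open>Cutting and pasting of subtrees: it yields both the pumped trees and the smaller tree
  that contradicts minimality. The node count is stated additively to avoid subtraction on
  naturals.\<close>

lemma occurs_replace:
  assumes "occurs t s u v" "valid G t" "valid G s'" "label s' = label s"
  obtains t' where "valid G t'" "label t' = label t" "yield t' = u @ yield s' @ v"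
    "nodes t' + nodes s = nodes t + nodes s'"
  using assms
proof (induction arbitrary: thesis rule: occurs.induct)
  case (child t s u v A ls rs)
  then obtain t' where "valid G t'" "label t' = label t" "yield t' = u @ yield s' @ v"
    "nodes t' + nodes s = nodes t + nodes s'"
    by auto
  with child.prems show ?case
    by (intro child.prems(1)[of "Node A (ls @ t' # rs)"]) auto
qed auto

lemma child_occurs: "c \<in> set ts \<Longrightarrow> occurs c s u v \<Longrightarrow> \<exists>u' v'. occurs (Node A ts) s u' v'"
  by (metis in_set_conv_decomp occurs.child)

lemma nodes_child: "c \<in> set ts \<Longrightarrow> nodes c < nodes (Node A ts)"
  by (simp add: less_Suc_eq_le member_le_sum_list)

lemma derives_yield: "valid G t \<Longrightarrow> (derives1 G)\<^sup>*\<^sup>* [label t] (map Tm (yield t))"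
proof (induction t)
  case (Node A ts)
  have "(derives1 G)\<^sup>*\<^sup>* (map label ss) (map Tm (concat (map yield ss)))" if "set ss \<subseteq> set ts" for ss
    using that
  proof (induction ss)
    case (Cons s ss)
    then have "(derives1 G)\<^sup>*\<^sup>* ([label s] @ map label ss)
        (map Tm (yield s) @ map Tm (concat (map yield ss)))"
      using Node by (intro derives_append) auto
    then show ?case by simp
  qed simp
  moreover have "derives1 G [NT A] (map label ts)"
    using Node.prems unfolding derives1_def valid.simps by (metis append_Nil append_Nil2)
  ultimately show ?case
    by (auto intro: converse_rtranclp_into_rtranclp)
qed simp

text \<open>Whole sentential forms, hence forests, let the induction run backwards from the terminal
  word: undoing a production puts the block of trees labelled by its right-hand side under one new
  node. This needs the left-hand side to be a single nonterminal.\<close>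

lemma derives_forest:
  assumes "context_free_grammar G" "(derives1 G)\<^sup>*\<^sup>* x (map Tm w)"
  shows "\<exists>ts. map label ts = x \<and> (\<forall>t \<in> set ts. valid G t) \<and> concat (map yield ts) = w"
  using assms(2)
proof (induction rule: converse_rtranclp_induct)
  case base
  have "map label (map Leaf w) = map Tm w" "concat (map yield (map Leaf w)) = w"
    by (induction w) auto
  then show ?case
    by (intro exI[of _ "map Leaf w"]) auto
next
  case (step x y)
  then obtain u v l r ts where lr: "(l, r) \<in> prods G" "x = u @ l @ v" "y = u @ r @ v"
    and ts: "map label ts = y" "\<forall>t \<in> set ts. valid G t" "concat (map yield ts) = w"
    by (auto simp: derives1_def)
  moreover from lr obtain A where "l = [NT A]"
    using assms(1) by (auto simp: context_free_grammar_def)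
  moreover from ts(1) lr(3) obtain t1 t2 t3 where "ts = t1 @ t2 @ t3"
    "map label t1 = u" "map label t2 = r" "map label t3 = v"
    by (auto simp: map_eq_append_conv append_eq_map_conv)
  ultimately show ?case
    by (intro exI[of _ "t1 @ [Node A t2] @ t3"]) auto
qed

lemma generated_language_tree_iff:
  assumes "context_free_grammar G"
  shows "w \<in> generated_language G \<longleftrightarrow> (\<exists>t. valid G t \<and> label t = NT (start G) \<and> yield t = w)"
proof
  assume "w \<in> generated_language G"
  then have "(derives1 G)\<^sup>*\<^sup>* [NT (start G)] (map Tm w)"
    by (simp add: generated_language_def)
  from derives_forest[OF assms this] show "\<exists>t. valid G t \<and> label t = NT (start G) \<and> yield t = w"
    by (auto simp: map_eq_Cons_conv)
qed (use derives_yield in \<open>force simp: generated_language_def\<close>)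

lemma length_yield_le:
  assumes "\<forall>(l, r) \<in> prods G. length r \<le> b" "b \<ge> 1" "valid G t"
  shows "length (yield t) \<le> b ^ height t"
  using assms(3)
proof (induction t)
  case (Node A ts)
  let ?m = "Max (insert 0 (height ` set ts))"
  have "length (yield t) \<le> b ^ ?m" if "t \<in> set ts" for t
  proof -
    have "height t \<le> ?m" using that by simp
    with Node that show ?thesis
      using assms(2) by (meson order_trans power_increasing valid.simps(2))
  qed
  then have "length (concat (map yield ts)) \<le> sum_list (map (\<lambda>_. b ^ ?m) ts)"
    unfolding length_concat map_map by (intro sum_list_mono) simp
  also have "\<dots> = length ts * b ^ ?m"
    by (simp add: sum_list_triv)
  also have "\<dots> \<le> b * b ^ ?m"
    using Node.prems assms(1) by fastforce
  finally show ?case by simp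
qed simp

text \<open>\<open>P\<close> collects the labels met on the way down to \<open>t\<close>; if no label of \<open>P\<close> recurs in \<open>t\<close>, then
  descending into a highest child enlarges \<open>P\<close>, which is bounded by \<open>V\<close>.\<close>

lemma repeated_label:
  assumes "finite V" "\<And>A r. ([NT A], r) \<in> prods G \<Longrightarrow> A \<in> V"
    and "valid G t" "P \<subseteq> V" "height t + card P > card V"
  shows "(\<exists>s u v. occurs t s u v \<and> label s \<in> NT ` P) \<or>
    (\<exists>A ts c u v s u' v'. occurs t (Node A ts) u v \<and> c \<in> set ts \<and> occurs c s u' v' \<and> label s = NT A)"
  using assms(3-)
proof (induction t arbitrary: P)
  case (Leaf a)
  then show ?case
    using card_mono[OF assms(1) Leaf.prems(2)] by simp
next
  case (Node A ts)
  show ?case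
  proof (cases "A \<in> P")
    case True
    then show ?thesis
      using occurs.refl by (metis imageI label.simps(2))
  next
    case False
    have fin: "finite P" using Node.prems(2) assms(1) finite_subset by blast
    have A: "A \<in> V" using Node.prems(1) assms(2) by auto
    \<comment> \<open>A childless node has height 1, so \<open>insert A P\<close> would have more
      than \<open>card V\<close> elements while lying inside \<open>V\<close>.\<close>
    have "ts \<noteq> []"
    proof
      assume "ts = []"
      then have "card (insert A P) > card V"
        using Node.prems(3) fin False by simp
      moreover have "insert A P \<subseteq> V"
        using A Node.prems(2) by simp
      ultimately show False
        using card_mono[OF assms(1), of "insert A P"] by simp
    qed
    then have "Max (insert 0 (height ` set ts)) = Max (height ` set ts)"
      by (cases ts) (auto simp: Max_insert)
    moreover have "Max (height ` set ts) \<in> height ` set ts"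
      using \<open>ts \<noteq> []\<close> by (intro Max_in) auto
    ultimately obtain c where c: "c \<in> set ts" "height (Node A ts) = Suc (height c)"
      by auto
    have "(\<exists>s u v. occurs c s u v \<and> label s \<in> NT ` insert A P) \<or>
      (\<exists>B ts c' u v s u' v'. occurs c (Node B ts) u v \<and> c' \<in> set ts \<and> occurs c' s u' v' \<and> label s = NT B)"
      using Node.prems c A False fin by (intro Node.IH) auto
    then show ?thesis
    proof (elim disjE exE conjE)
      fix s u v assume s: "occurs c s u v" "label s \<in> NT ` insert A P"
      show ?thesis
      proof (cases "label s = NT A")
        case True
        then show ?thesis
          using c(1) s(1) occurs.refl by blast
      next
        case False
        with s(2) have "label s \<in> NT ` P" by auto
        then show ?thesis
          using child_occurs[OF c(1) s(1)] by blast
      qed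
    next
      fix B us c' u v s u' v'
      assume *: "occurs c (Node B us) u v" "c' \<in> set us" "occurs c' s u' v'" "label s = NT B"
      obtain u0 v0 where "occurs (Node A ts) (Node B us) u0 v0"
        using child_occurs[OF c(1) *(1)] by blast
      with *(2-) show ?thesis
        by blast
    qed
  qed
qed

text \<open>Without a normal form, empty and unit productions could make a repeated label pump
  nothing. Two minimal choices take care of this: \<open>t\<close> has the fewest nodes among the
  parse trees of the word, which makes \<open>v @ y\<close> nonempty, and \<open>q\<close> has the
  fewest nodes among its subtrees with a repeated root label, which bounds
  \<open>v @ x @ y\<close>.\<close>

theorem pumping_lemma:
  assumes "context_free_language L"
  shows "\<exists>p>0. \<forall>z \<in> L. length z \<ge> p \<longrightarrow>
    (\<exists>u v x y w. z = u @ v @ x @ y @ w \<and> length (v @ x @ y) \<le> p \<and> v @ y \<noteq> [] \<and>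
      (\<forall>i. u @ concat (replicate i v) @ x @ concat (replicate i y) @ w \<in> L))"
proof -
  obtain G where G: "context_free_grammar G" and L: "generated_language G = L"
    using assms by (auto simp: context_free_language_def)
  define V where "V = {A. \<exists>r. ([NT A], r) \<in> prods G}"
  \<comment> \<open>The \<open>Suc\<close> keeps the branching bound positive even if all right-hand
    sides are empty.\<close>
  define b where "b = Suc (Max (insert 0 (length ` snd ` prods G)))"
  \<comment> \<open>The children of \<open>q\<close> will have height at most \<open>card V\<close>,
    hence the exponent. The pumping constant is \<open>Suc p\<close>, so that a word of that length
    is too long for a tree of height \<open>card V\<close>.\<close>
  define p where "p = b ^ Suc (card V)"
  have fin: "finite (prods G)"
    using G by (simp add: context_free_grammar_def)
  have len: "\<forall>(l, r) \<in> prods G. length r \<le> b"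
  proof clarify
    fix l r assume "(l, r) \<in> prods G"
    then have "length r \<in> length ` snd ` prods G" by force
    then show "length r \<le> b" using fin unfolding b_def by (simp add: le_SucI)
  qed
  \<comment> \<open>The nonterminals in \<open>V\<close> are read off the left-hand sides; the 0 is
    a dummy for terminals.\<close>
  have "V \<subseteq> (\<lambda>(l, r). case hd l of NT A \<Rightarrow> A | _ \<Rightarrow> 0) ` prods G"
    unfolding V_def by force
  then have finV: "finite V"
    using fin finite_subset by blast
  have "b \<ge> 1" by (simp add: b_def)
  have V: "A \<in> V" if "([NT A], r) \<in> prods G" for A r
    using that by (auto simp: V_def)
  have main: "\<exists>u v x y w. z = u @ v @ x @ y @ w \<and> length (v @ x @ y) \<le> Suc p \<and> v @ y \<noteq> [] \<and>
      (\<forall>i. u @ concat (replicate i v) @ x @ concat (replicate i y) @ w \<in> L)"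
    if z: "z \<in> L" and long: "length z \<ge> Suc p" for z
  proof -
    define T where "T t \<longleftrightarrow> valid G t \<and> label t = NT (start G) \<and> yield t = z" for t
    have "\<exists>t. T t"
      using z L generated_language_tree_iff[OF G] by (auto simp: T_def)
    then obtain t where t: "T t" and min: "\<And>t'. T t' \<Longrightarrow> nodes t \<le> nodes t'"
      by (metis arg_min_natI arg_min_nat_le)
    have "height t > card V"
    proof (rule ccontr)
      assume "\<not> height t > card V"
      then have "b ^ height t \<le> p"
        unfolding p_def using \<open>b \<ge> 1\<close> by (intro power_increasing) auto
      then show False
        using length_yield_le[OF len \<open>b \<ge> 1\<close>, where t = t] t long by (auto simp: T_def)
    qed
    define Rep where "Rep q \<longleftrightarrow> (\<exists>A ts c u v s u' v'. q = Node A ts \<and> occurs t q u v \<and>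
      c \<in> set ts \<and> occurs c s u' v' \<and> label s = NT A)" for q
    \<comment> \<open>Used for \<open>t\<close> itself, to obtain a repetition at all, and for the
      children of \<open>q\<close>, where too great a height would give a repetition smaller than
      \<open>q\<close>.\<close>
    have repI: "\<exists>q. Rep q \<and> nodes q \<le> nodes c" if c: "occurs t c u0 v0" "height c > card V" for c u0 v0
    proof -
      have "valid G c" using occurs_valid[OF c(1)] t by (auto simp: T_def)
      then have "\<exists>A ts c' u v s u' v'. occurs c (Node A ts) u v \<and> c' \<in> set ts \<and>
          occurs c' s u' v' \<and> label s = NT A"
        using repeated_label[where G = G and t = c and P = "{}", OF finV V] c(2) by simp
      then obtain A ts c' u v s u' v' where *: "occurs c (Node A ts) u v" "c' \<in> set ts"
        "occurs c' s u' v'" "label s = NT A"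
        by blast
      then have "Rep (Node A ts)"
        unfolding Rep_def using occurs_trans[OF c(1) *(1)] by blast
      then show ?thesis
        using occurs_nodes[OF *(1)] by blast
    qed
    have "\<exists>q. Rep q"
      using repI[OF occurs.refl \<open>height t > card V\<close>] by blast
    then obtain q where q: "Rep q" and qmin: "\<And>q'. Rep q' \<Longrightarrow> nodes q \<le> nodes q'"
      by (metis arg_min_natI arg_min_nat_le)
    then obtain A ts c u w s v0 y0 where qd: "q = Node A ts" "occurs t q u w" "c \<in> set ts"
      "occurs c s v0 y0" "label s = NT A"
      unfolding Rep_def by blast
    obtain v y where vy: "occurs q s v y"
      using child_occurs[OF qd(3,4)] qd(1) by blast
    have valid: "valid G q" "valid G s" "valid G t"
      using occurs_valid[OF qd(2)] occurs_valid[OF vy] t by (auto simp: T_def)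
    have small: "nodes s < nodes q"
      using occurs_nodes[OF qd(4)] nodes_child[OF qd(3)] qd(1) by fastforce
    have "height c' \<le> card V" if c': "c' \<in> set ts" for c'
    proof (rule ccontr)
      assume "\<not> height c' \<le> card V"
      moreover obtain u1 v1 where "occurs q c' u1 v1"
        using child_occurs[OF c' occurs.refl, of A] qd(1) by blast
      note occurs_trans[OF qd(2) this]
      ultimately obtain q' where "Rep q'" "nodes q' \<le> nodes c'"
        using repI by (meson not_le)
      then show False
        using qmin[of q'] nodes_child[OF c', of A] qd(1) by simp
    qed
    then have "height q \<le> Suc (card V)"
      using qd(1) by auto
    then have "b ^ height q \<le> p"
      unfolding p_def using \<open>b \<ge> 1\<close> by (intro power_increasing) auto
    then have qlen: "length (yield q) \<le> p"
      using length_yield_le[OF len \<open>b \<ge> 1\<close> valid(1)] by simp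
    have z_eq: "z = u @ v @ yield s @ y @ w"
      using occurs_yield[OF qd(2)] occurs_yield[OF vy] t by (simp add: T_def)
    \<comment> \<open>Otherwise pasting \<open>s\<close> in place of \<open>q\<close> would give a
      parse tree of the same word with fewer nodes.\<close>
    have "v @ y \<noteq> []"
    proof
      assume "v @ y = []"
      moreover obtain t' where t': "valid G t'" "label t' = label t" "yield t' = u @ yield s @ w"
        "nodes t' + nodes q = nodes t + nodes s"
        using occurs_replace[OF qd(2) valid(3,2)] qd by auto
      ultimately have "T t'"
        using t z_eq by (auto simp: T_def)
      then show False
        using min[of t'] t'(4) small by simp
    qed
    moreover have "u @ concat (replicate i v) @ yield s @ concat (replicate i y) @ w \<in> L" for i
    proof -
      have "\<exists>q'. valid G q' \<and> label q' = NT A \<and>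
        yield q' = concat (replicate i v) @ yield s @ concat (replicate i y)"
      proof (induction i)
        case 0
        then show ?case using valid(2) qd(5) by auto
      next
        case (Suc i)
        then obtain q' where q': "valid G q'" "label q' = NT A"
          "yield q' = concat (replicate i v) @ yield s @ concat (replicate i y)" by blast
        obtain q'' where "valid G q''" "label q'' = label q" "yield q'' = v @ yield q' @ y"
          using occurs_replace[OF vy valid(1) q'(1)] q'(2) qd(5) by auto
        moreover have "concat (replicate i y) @ y = y @ concat (replicate i y)"
          by (induction i) auto
        ultimately show ?case
          using q'(3) qd(1) by (intro exI[of _ q'']) auto
      qed
      then obtain q' where q': "valid G q'" "label q' = NT A"
        "yield q' = concat (replicate i v) @ yield s @ concat (replicate i y)" by blast
      obtain t' where "valid G t'" "label t' = label t" "yield t' = u @ yield q' @ w"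
        using occurs_replace[OF qd(2) valid(3) q'(1)] q'(2) qd(1) by auto
      then show ?thesis
        using generated_language_tree_iff[OF G] L t q'(3) by (auto simp: T_def)
    qed
    ultimately show ?thesis
      using z_eq qlen occurs_yield[OF vy]
      by (intro exI[of _ u] exI[of _ v] exI[of _ "yield s"] exI[of _ y] exI[of _ w]) auto
  qed
  show ?thesis
    by (rule exI[of _ "Suc p"]) (intro conjI ballI impI main zero_less_Suc)
qed

section \<open>Two names violate the pumping property\<close>

lemma not_context_free_balanced_words:
  assumes letters: "{ra, rb, oa, ob} \<subseteq> A"
    and kinds: "kind ra = Req a" "kind rb = Req b" "kind oa = Off a" "kind ob = Off b"
    and "a \<noteq> b"
  shows "\<not> context_free_language (balanced_words kind A)"
proof
  assume *: "context_free_language (balanced_words kind A)"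
  obtain p where "p > 0"
    and pump: "\<And>z. z \<in> balanced_words kind A \<Longrightarrow> length z \<ge> p \<Longrightarrow>
      \<exists>u v x y w. z = u @ v @ x @ y @ w \<and> length (v @ x @ y) \<le> p \<and> v @ y \<noteq> [] \<and>
      (\<forall>i. u @ concat (replicate i v) @ x @ concat (replicate i y) @ w \<in> balanced_words kind A)"
    using pumping_lemma[OF *] by blast
  define z where "z = replicate p ra @ replicate p rb @ replicate p oa @ replicate p ob"
  define N where "N k m = count (image_mset kind (mset m)) k" for k m
  have N_append: "N k (x @ y) = N k x + N k y" for k x y
    by (simp add: N_def)
  have N_pos: "N (kind c) m > 0" if "c \<in> set m" for c m
    using that by (auto simp: N_def count_image_mset_nth card_gt_0_iff in_set_conv_nth)
  have N_posD: "\<exists>c \<in> set m. kind c = k" if "N k m > 0" for k m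
    using that by (auto simp: N_def count_image_mset_nth card_gt_0_iff)
  have balanced: "N (Req c) m \<le> N (Off c) m" if "m \<in> balanced_words kind A" for c m
    using that by (auto simp: balanced_words_def balanced_def N_def)
  have Nz: "N (Req c) z = N (Off c) z" for c
    using kinds by (simp add: N_def z_def image_replicate_mset)
  have "z \<in> balanced_words kind A"
    using letters Nz by (auto simp: z_def balanced_words_def balanced_def N_def)
  then obtain u v x y w where z: "z = u @ v @ x @ y @ w" and len: "length (v @ x @ y) \<le> p"
    and ne: "v @ y \<noteq> []"
    and pumped: "\<And>i. u @ concat (replicate i v) @ x @ concat (replicate i y) @ w \<in> balanced_words kind A"
    using pump[of z] by (auto simp: z_def)
  \<comment> \<open>In \<open>z\<close> requests and offers are in exact balance. Deleting
    \<open>v @ y\<close> must not remove more offers than requests, and doubling it must not add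
    more requests than offers.\<close>
  have Neq: "N (Req c) (v @ y) = N (Off c) (v @ y)" for c
    using balanced[OF pumped[of 0], of c] balanced[OF pumped[of 2], of c] Nz[of c]
    by (simp add: z N_append numeral_2_eq_2)
  have zlen: "length z = 4 * p" by (simp add: z_def)
  have znth: "z ! i = (if i < p then ra else if i < 2 * p then rb else if i < 3 * p then oa else ob)"
    if "i < 4 * p" for i
    using that by (auto simp: z_def nth_append)
  have window: "\<exists>i. z ! i = c \<and> length u \<le> i \<and> i < length u + p \<and> i < 4 * p" if c: "c \<in> set (v @ y)" for c
  proof -
    from c have "c \<in> set (v @ x @ y)" by auto
    then obtain i where "i < length (v @ x @ y)" "(v @ x @ y) ! i = c"
      by (meson in_set_conv_nth)
    then show ?thesis
      using len z zlen by (intro exI[of _ "length u + i"]) (auto simp: nth_append)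
  qed
  have kind_z: "kind (z ! i) = (if i < p then Req a else if i < 2 * p then Req b
      else if i < 3 * p then Off a else Off b)" if "i < 4 * p" for i
    using znth[OF that] kinds by simp
  \<comment> \<open>Requests and offers on the same name are separated in \<open>z\<close> by a full
    block of length \<open>p\<close>, so they do not fit into one window. By \<open>Neq\<close>, a
    request in \<open>v @ y\<close> would bring such an offer along.\<close>
  have no: "N (Req c) (v @ y) = 0" for c
  proof (rule ccontr)
    assume "N (Req c) (v @ y) \<noteq> 0"
    then obtain r s where rs: "r \<in> set (v @ y)" "kind r = Req c" "s \<in> set (v @ y)" "kind s = Off c"
      using N_posD[of "Req c" "v @ y"] N_posD[of "Off c" "v @ y"] Neq[of c] by auto
    with window[OF rs(1)] window[OF rs(3)] obtain i j where "kind (z ! i) = Req c" "i < 4 * p" "kind (z ! j) = Off c" "j < 4 * p"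
      "i < length u + p" "length u \<le> i" "j < length u + p" "length u \<le> j"
      by auto
    then show False
      using \<open>a \<noteq> b\<close> by (simp add: kind_z split: if_splits)
  qed
  obtain c where c: "c \<in> set (v @ y)"
    using ne by (meson hd_in_set)
  from window[OF c] have "kind c \<noteq> Idle"
    by (auto simp: kind_z split: if_splits)
  then obtain d where "kind c = Req d \<or> kind c = Off d"
    by (cases "kind c") auto
  then show False
    using N_pos[OF c] no[of d] Neq[of d] by auto
qed


section \<open>A context-sensitive grammar\<close>

text \<open>Grammars and machines name nonterminals and states by natural numbers; a coding with a
  left inverse allows both to be built over structured datatypes.\<close>

lemma finite_coding:
  assumes "finite X"
  shows "\<exists>(e :: 'x \<Rightarrow> nat) d. \<forall>x \<in> X. d (e x) = x"
proof -
  from finite_imp_inj_to_nat_seg[OF assms] obtain f :: "'x \<Rightarrow> nat" where "inj_on f X"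
    by blast
  then show ?thesis
    by (intro exI[of _ f] exI[of _ "inv_into X f"]) simp
qed

text \<open>
  A mover carries a letter to the right of a letter \<open>c\<close> in the steps
  \<open>Mover p, Letter c \<rightarrow> Mover p, Swap p c \<rightarrow> Passed c, Swap p c \<rightarrow> Passed c, Mover p \<rightarrow> Letter c, Mover p\<close>,
  each of which rewrites a single nonterminal. A \<open>Swap p c\<close> stands for \<open>p\<close> exactly when the symbol before
  it is \<open>Passed c\<close>, and for \<open>c\<close> otherwise; this reading makes every step preserve the letters
  represented. With \<open>Letter c\<close> in place of \<open>Passed c\<close> this would fail, because the symbol before a \<open>Swap p c\<close>
  could then be rewritten.
\<close>

datatype 't cell = Start | Grow | Letter 't | Passed 't | Mover 't | Swap 't 't

definition cells :: "'t set \<Rightarrow> 't cell set" where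
  "cells A = {Start, Grow} \<union> Letter ` A \<union> Passed ` A \<union> Mover ` A \<union> (\<lambda>(p, c). Swap p c) ` (A \<times> A)"

locale balanced_grammar =
  fixes A :: "'t set" and kind :: "'t \<Rightarrow> 'a action"
    and e :: "'t cell \<Rightarrow> nat" and d :: "nat \<Rightarrow> 't cell"
  assumes finite_A: "finite A" and decode: "\<And>x. x \<in> cells A \<Longrightarrow> d (e x) = x"
begin

abbreviation nt :: "'t cell \<Rightarrow> 't gsym" where
  "nt x \<equiv> NT (e x)"

abbreviation bal :: "'t list \<Rightarrow> bool" where
  "bal w \<equiv> balanced (image_mset kind (mset w))"

text \<open>\<open>Grow\<close> cannot be erased by a context-sensitive rule, so the option
  \<open>g = []\<close> ends the growth together with the emission of the last letter. The same
  holds for \<open>pair_rules\<close>.\<close>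

definition single_rules :: "('t gsym list \<times> 't gsym list) set" where
  "single_rules = (\<lambda>(c, g). ([nt Grow], g @ [nt (Letter c)])) ` ({c \<in> A. bal [c]} \<times> {[], [nt Grow]})"

definition pair_rules :: "('t gsym list \<times> 't gsym list) set" where
  "pair_rules = (\<lambda>((c, p), g). ([nt Grow], g @ [nt (Letter c), nt (Mover p)])) `
    ({(c, p) \<in> A \<times> A. bal [c, p]} \<times> {[], [nt Grow]})"

definition swap_rules :: "('t gsym list \<times> 't gsym list) set" where
  "swap_rules =
    (\<lambda>(p, c). ([nt (Mover p), nt (Letter c)], [nt (Mover p), nt (Swap p c)])) ` (A \<times> A) \<union>
    (\<lambda>(p, c). ([nt (Mover p), nt (Swap p c)], [nt (Passed c), nt (Swap p c)])) ` (A \<times> A) \<union>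
    (\<lambda>(p, c). ([nt (Passed c), nt (Swap p c)], [nt (Passed c), nt (Mover p)])) ` (A \<times> A) \<union>
    (\<lambda>(p, c). ([nt (Passed c), nt (Mover p)], [nt (Letter c), nt (Mover p)])) ` (A \<times> A)"

definition final_rules :: "('t gsym list \<times> 't gsym list) set" where
  "final_rules = (\<lambda>p. ([nt (Mover p)], [nt (Letter p)])) ` A \<union> (\<lambda>c. ([nt (Letter c)], [Tm c])) ` A"

definition G :: "'t grammar" where
  "G = \<lparr>start = e Start, prods = {([nt Start], []), ([nt Start], [nt Grow])} \<union>
    single_rules \<union> pair_rules \<union> swap_rules \<union> final_rules\<rparr>"

lemmas rules_defs = single_rules_def pair_rules_def swap_rules_def final_rules_def

lemma e_eq_iff: "x \<in> cells A \<Longrightarrow> y \<in> cells A \<Longrightarrow> e x = e y \<longleftrightarrow> x = y"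
  by (metis decode)

lemma cells_iff [simp]: "Start \<in> cells A" "Grow \<in> cells A" "Letter c \<in> cells A \<longleftrightarrow> c \<in> A"
  "Passed c \<in> cells A \<longleftrightarrow> c \<in> A" "Mover c \<in> cells A \<longleftrightarrow> c \<in> A"
  "Swap p c \<in> cells A \<longleftrightarrow> p \<in> A \<and> c \<in> A"
  by (auto simp: cells_def)

lemma start_not_in_rhs: "(l, r) \<in> prods G \<Longrightarrow> nt Start \<notin> set r"
  by (auto simp: G_def rules_defs e_eq_iff)

lemma context_sensitive_G: "context_sensitive_grammar G"
proof -
  have "finite {(c, p) \<in> A \<times> A. bal [c, p]}"
    by (rule finite_subset[of _ "A \<times> A"]) (use finite_A in auto)
  then have fin: "finite (prods G)"
    using finite_A by (simp add: G_def rules_defs)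
  \<comment> \<open>Apart from the empty start rule, every rule rewrites one nonterminal with no
    context or with a single symbol of context on one side.\<close>
  have split: "\<exists>\<beta> X \<delta> \<gamma>. l = \<beta> @ [NT X] @ \<delta> \<and> r = \<beta> @ \<gamma> @ \<delta> \<and> \<gamma> \<noteq> []"
    if "l = \<beta> @ [NT X] @ \<delta>" "r = \<beta> @ \<gamma> @ \<delta>" "\<gamma> \<noteq> []" for l r \<beta> X \<delta> and \<gamma> :: "'t gsym list"
    using that by blast
  have one: "\<exists>\<beta> X \<delta> \<gamma>. l = \<beta> @ [NT X] @ \<delta> \<and> r = \<beta> @ \<gamma> @ \<delta> \<and> \<gamma> \<noteq> []"
    if "l = [NT X]" "r \<noteq> []" for l r :: "'t gsym list" and X
    using that split[of l "[]" X "[]" r r] by simp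
  have left: "\<exists>\<beta> X \<delta> \<gamma>. l = \<beta> @ [NT X] @ \<delta> \<and> r = \<beta> @ \<gamma> @ \<delta> \<and> \<gamma> \<noteq> []"
    if "l = [NT X, y]" "r = [x', y]" for l r and x' y :: "'t gsym" and X
    using that split[of l "[]" X "[y]" r "[x']"] by simp
  have right: "\<exists>\<beta> X \<delta> \<gamma>. l = \<beta> @ [NT X] @ \<delta> \<and> r = \<beta> @ \<gamma> @ \<delta> \<and> \<gamma> \<noteq> []"
    if "l = [y, NT X]" "r = [y, x']" for l r and x' y :: "'t gsym" and X
    using that split[of l "[y]" X "[]" r "[x']"] by simp
  have form: "(\<exists>\<beta> X \<delta> \<gamma>. l = \<beta> @ [NT X] @ \<delta> \<and> r = \<beta> @ \<gamma> @ \<delta> \<and> \<gamma> \<noteq> []) \<or> l = [nt Start] \<and> r = []"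
    if lr: "(l, r) \<in> prods G" for l r
  proof -
    consider "l = [nt Start]" "r = []" | X where "l = [NT X]" "r \<noteq> []"
      | X x' y where "l = [NT X, y]" "r = [x', y]" | X x' y where "l = [y, NT X]" "r = [y, x']"
      using lr by (auto simp: G_def rules_defs)
    then show ?thesis
    proof cases
      case 2
      then show ?thesis using one by (intro disjI1) simp
    next
      case 3
      from left[OF this] show ?thesis by (rule disjI1)
    next
      case 4
      from right[OF this] show ?thesis by (rule disjI1)
    qed simp
  qed
  show ?thesis
    unfolding context_sensitive_grammar_def
  proof (intro conjI fin ballI)
    fix lr assume "lr \<in> prods G"
    moreover obtain l r where lr: "lr = (l, r)" by fastforce
    ultimately consider "\<exists>\<beta> X \<delta> \<gamma>. l = \<beta> @ [NT X] @ \<delta> \<and> r = \<beta> @ \<gamma> @ \<delta> \<and> \<gamma> \<noteq> []"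
      | "l = [nt Start]" "r = []"
      using form by blast
    then show "case lr of (l, r) \<Rightarrow>
        (\<exists>\<beta> X \<delta> \<gamma>. l = \<beta> @ [NT X] @ \<delta> \<and> r = \<beta> @ \<gamma> @ \<delta> \<and> \<gamma> \<noteq> []) \<or>
        l = [NT (start G)] \<and> r = [] \<and> (\<forall>(l', r') \<in> prods G. NT (start G) \<notin> set r')"
    proof cases
      case 1
      then show ?thesis
        unfolding lr prod.case by (rule disjI1)
    next
      case 2
      moreover have "start G = e Start"
        by (simp add: G_def)
      ultimately show ?thesis
        using start_not_in_rhs lr by auto
    qed
  qed
qed

section \<open>Soundness: the letters represented by a sentential form\<close>

definition sym_content :: "'t gsym \<Rightarrow> 't gsym \<Rightarrow> 't multiset" where
  "sym_content prev s = (case s of Tm t \<Rightarrow> {#t#} | NT k \<Rightarrow> (case d k of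
      Start \<Rightarrow> {#} | Grow \<Rightarrow> {#} | Letter c \<Rightarrow> {#c#} | Passed c \<Rightarrow> {#c#} | Mover p \<Rightarrow> {#p#}
    | Swap p c \<Rightarrow> (if prev = nt (Passed c) then {#p#} else {#c#})))"

fun content :: "'t gsym \<Rightarrow> 't gsym list \<Rightarrow> 't multiset" where
  "content prev [] = {#}"
| "content prev (s # x) = sym_content prev s + content s x"

lemma content_append: "content prev (x @ y) = content prev x + content (last (prev # x)) y"
  by (induction x arbitrary: prev) auto

lemma content_terminals: "content prev (map Tm w) = mset w"
  by (induction w arbitrary: prev) (auto simp: sym_content_def)

text \<open>Only a \<open>Swap\<close> at the head of \<open>x\<close> consults its predecessor, and
  only to test it for a \<open>Passed\<close>.\<close>

lemma content_cong:
  assumes "\<forall>c \<in> A. q \<noteq> nt (Passed c) \<and> q' \<noteq> nt (Passed c)" "set x \<subseteq> Tm ` A \<union> nt ` cells A"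
  shows "content q x = content q' x"
  using assms by (cases x) (auto simp: sym_content_def decode split: cell.splits, blast+)

text \<open>\<open>N\<close> holds the letters emitted by a growth rule and is empty for all other
  rules. Neither side of a rule ends in a \<open>Passed\<close>, so what follows is read as before;
  neither side begins with a \<open>Swap\<close>, so what precedes is irrelevant.\<close>

lemma content_step:
  assumes lr: "(l, r) \<in> prods G" and "l \<noteq> [nt Start]"
    and v: "set v \<subseteq> Tm ` A \<union> nt ` cells A"
  obtains N where "balanced (image_mset kind N)" "content q (u @ r @ v) = content q (u @ l @ v) + N"
proof -
  note [simp] = content_append sym_content_def decode e_eq_iff
  have eq: "content a v = content b v" if "\<forall>c \<in> A. a \<noteq> nt (Passed c) \<and> b \<noteq> nt (Passed c)" for a b
    using content_cong[OF that v] .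
  from lr consider (single) "(l, r) \<in> single_rules" | (pair) "(l, r) \<in> pair_rules"
    | (swap) "(l, r) \<in> swap_rules" | (final) "(l, r) \<in> final_rules"
    using assms(2) by (auto simp: G_def)
  then show thesis
  proof cases
    case single
    then obtain c g where "c \<in> A" "bal [c]" "g \<in> {[], [nt Grow]}" "l = [nt Grow]" "r = g @ [nt (Letter c)]"
      by (auto simp: single_rules_def)
    then show thesis
      using eq[of "nt (Letter c)" "nt Grow"] by (intro that[of "{#c#}"]) auto
  next
    case pair
    then obtain c p g where "c \<in> A" "p \<in> A" "bal [c, p]" "g \<in> {[], [nt Grow]}" "l = [nt Grow]"
      "r = g @ [nt (Letter c), nt (Mover p)]"
      by (auto simp: pair_rules_def)
    then show thesis
      using eq[of "nt (Mover p)" "nt Grow"] by (intro that[of "{#c, p#}"]) auto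
  next
    case swap
    then consider
        p c where "p \<in> A" "c \<in> A" "l = [nt (Mover p), nt (Letter c)]" "r = [nt (Mover p), nt (Swap p c)]"
      | p c where "p \<in> A" "c \<in> A" "l = [nt (Mover p), nt (Swap p c)]" "r = [nt (Passed c), nt (Swap p c)]"
      | p c where "p \<in> A" "c \<in> A" "l = [nt (Passed c), nt (Swap p c)]" "r = [nt (Passed c), nt (Mover p)]"
      | p c where "p \<in> A" "c \<in> A" "l = [nt (Passed c), nt (Mover p)]" "r = [nt (Letter c), nt (Mover p)]"
      unfolding swap_rules_def by auto
    then show thesis
    proof cases
      case (1 p c)
      then show thesis
        using eq[of "nt (Letter c)" "nt (Swap p c)"] by (intro that[of "{#}"]) auto
    next
      \<comment> \<open>The two symbols exchange the letters they stand for: the left one turns from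
        \<open>p\<close> to \<open>c\<close>, which flips the reading of the unchanged
        \<open>Swap\<close> from \<open>c\<close> to \<open>p\<close>.\<close>
      case (2 p c)
      then show thesis by (intro that[of "{#}"]) auto
    next
      case (3 p c)
      then show thesis
        using eq[of "nt (Mover p)" "nt (Swap p c)"] by (intro that[of "{#}"]) auto
    next
      case (4 p c)
      then show thesis by (intro that[of "{#}"]) auto
    qed
  next
    case final
    then obtain p where "p \<in> A" "l = [nt (Mover p)] \<and> r = [nt (Letter p)] \<or> l = [nt (Letter p)] \<and> r = [Tm p]"
      by (auto simp: final_rules_def)
    then show thesis
      using eq[of "nt (Mover p)" "nt (Letter p)"] eq[of "nt (Letter p)" "Tm p"]
      by (intro that[of "{#}"]) auto
  qed
qed

lemma rhs_symbols: "(l, r) \<in> prods G \<Longrightarrow> set r \<subseteq> Tm ` A \<union> nt ` cells A"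
  by (auto simp: G_def rules_defs)

text \<open>The condition on \<open>Start\<close> confines the start rules to the initial form; all
  other steps add a balanced multiset. The condition on the symbols is what the reading of the right
  context requires.\<close>

lemma sound:
  assumes "(derives1 G)\<^sup>*\<^sup>* [nt Start] x"
  shows "set x \<subseteq> Tm ` A \<union> nt ` cells A \<and> (x = [nt Start] \<or> nt Start \<notin> set x) \<and>
    balanced (image_mset kind (content (nt Start) x))"
  using assms
proof induction
  case base
  then show ?case by (auto simp: sym_content_def decode)
next
  case (step y z)
  then obtain u v l r where lr: "(l, r) \<in> prods G" and y: "y = u @ l @ v" and z: "z = u @ r @ v"
    by (auto simp: derives1_def)
  show ?case
  proof (cases "l = [nt Start]")
    case True
    then have "u = []" "v = []"
      using step.IH y by (auto simp: Cons_eq_append_conv append_eq_Cons_conv)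
    moreover have "r = [] \<or> r = [nt Grow]"
      using lr True by (auto simp: G_def rules_defs e_eq_iff)
    ultimately show ?thesis
      using z by (auto simp: sym_content_def decode e_eq_iff)
  next
    case False
    moreover have "y \<noteq> [nt Start]"
    proof
      assume "y = [nt Start]"
      with y False have "l = []"
        by (auto simp: Cons_eq_append_conv append_eq_Cons_conv)
      with lr show False by (auto simp: G_def rules_defs)
    qed
    moreover have "set v \<subseteq> Tm ` A \<union> nt ` cells A"
      using step.IH y by auto
    ultimately obtain N where "balanced (image_mset kind N)"
      "content (nt Start) z = content (nt Start) y + N"
      using content_step[OF lr, of v "nt Start" u] y z by blast
    then show ?thesis
      using step.IH \<open>y \<noteq> [nt Start]\<close> y z start_not_in_rhs[OF lr] rhs_symbols[OF lr]
      by (auto simp: balanced_union)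
  qed
qed

section \<open>Completeness: deriving every balanced word\<close>

lemma derives_rule: "(l, r) \<in> prods G \<Longrightarrow> (derives1 G)\<^sup>*\<^sup>* l r"
  using derives_production[of l r G "[]" "[]"] by simp

lemma derives_trans [trans]:
  "(derives1 G)\<^sup>*\<^sup>* x y \<Longrightarrow> (derives1 G)\<^sup>*\<^sup>* y z \<Longrightarrow> (derives1 G)\<^sup>*\<^sup>* x z"
  by (rule rtranclp_trans)

abbreviation letters :: "'t list \<Rightarrow> 't gsym list" where
  "letters w \<equiv> map (\<lambda>c. nt (Letter c)) w"

lemma derives_swap:
  assumes "p \<in> A" "c \<in> A"
  shows "(derives1 G)\<^sup>*\<^sup>* [nt (Mover p), nt (Letter c)] [nt (Letter c), nt (Mover p)]"
proof -
  have "(derives1 G)\<^sup>*\<^sup>* [nt (Mover p), nt (Letter c)] [nt (Mover p), nt (Swap p c)]"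
    using assms by (intro derives_rule) (force simp: G_def swap_rules_def)
  also have "(derives1 G)\<^sup>*\<^sup>* [nt (Mover p), nt (Swap p c)] [nt (Passed c), nt (Swap p c)]"
    using assms by (intro derives_rule) (force simp: G_def swap_rules_def)
  also have "(derives1 G)\<^sup>*\<^sup>* [nt (Passed c), nt (Swap p c)] [nt (Passed c), nt (Mover p)]"
    using assms by (intro derives_rule) (force simp: G_def swap_rules_def)
  also have "(derives1 G)\<^sup>*\<^sup>* [nt (Passed c), nt (Mover p)] [nt (Letter c), nt (Mover p)]"
    using assms by (intro derives_rule) (force simp: G_def swap_rules_def)
  finally show ?thesis .
qed

lemma derives_move:
  assumes "p \<in> A" "set u \<subseteq> A"
  shows "(derives1 G)\<^sup>*\<^sup>* (nt (Mover p) # letters u) (letters u @ [nt (Letter p)])"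
  using assms(2)
proof (induction u)
  case Nil
  show ?case
    using assms(1) by (intro derives_rule) (auto simp: G_def final_rules_def)
next
  case (Cons c u)
  then have "(derives1 G)\<^sup>*\<^sup>* ([nt (Mover p), nt (Letter c)] @ letters u)
      ([nt (Letter c), nt (Mover p)] @ letters u)"
    using assms(1) by (intro derives_append derives_swap) auto
  also have "[nt (Letter c), nt (Mover p)] @ letters u = [nt (Letter c)] @ nt (Mover p) # letters u"
    by simp
  also have "(derives1 G)\<^sup>*\<^sup>* \<dots> ([nt (Letter c)] @ letters u @ [nt (Letter p)])"
    using Cons by (intro derives_append) auto
  finally show ?case by simp
qed

text \<open>The alternatives mirror the two kinds of growth rules. A request needs a later offer as
  partner. An offer needs a partner only if \<open>w\<close> is unbalanced without it, and then the
  excess request in \<open>w\<close> must be on the same name.\<close>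

lemma balanced_decompose:
  assumes "bal (c # w)"
  shows "bal [c] \<and> bal w \<or> (\<exists>u p v. w = u @ p # v \<and> bal [c, p] \<and> bal (u @ v))"
proof -
  have split: "\<exists>u p v. w = u @ p # v \<and> kind p = k" if "count (image_mset kind (mset w)) k > 0" for k
  proof -
    have "k \<in># image_mset kind (mset w)"
      using that by (rule count_greater_zero_iff[THEN iffD1])
    then obtain p where "p \<in> set w" "kind p = k"
      by auto
    then show ?thesis
      using split_list by fast
  qed
  show ?thesis
  proof (cases "kind c")
    case (Req a)
    then have "Suc (count (image_mset kind (mset w)) (Req a)) \<le> count (image_mset kind (mset w)) (Off a)"
      using assms by (auto simp: balanced_def dest!: spec[of _ a])
    then have "count (image_mset kind (mset w)) (Off a) > 0"
      by linarith
    then obtain u p v where w: "w = u @ p # v" "kind p = Off a"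
      using split by blast
    have "bal (u @ v)"
      using assms w Req by (auto simp: balanced_def split: if_splits)
    moreover have "bal [c, p]"
      using w Req by (auto simp: balanced_def)
    ultimately show ?thesis using w by blast
  next
    case (Off a)
    show ?thesis
    proof (cases "bal w")
      case True
      then show ?thesis using Off by (auto simp: balanced_def)
    next
      case False
      then obtain b where b: "count (image_mset kind (mset w)) (Req b) > count (image_mset kind (mset w)) (Off b)"
        by (auto simp: balanced_def not_le)
      moreover have "count (image_mset kind (mset (c # w))) (Req b) \<le> count (image_mset kind (mset (c # w))) (Off b)"
        using assms by (simp only: balanced_def)
      ultimately have "b = a"
        using Off by (auto split: if_splits)
      with b have "count (image_mset kind (mset w)) (Req a) > 0"
        by (metis not_less_zero not_gr_zero)
      then obtain u p v where w: "w = u @ p # v" "kind p = Req a"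
        using split by blast
      have "bal (u @ v)"
        using assms w Off by (auto simp: balanced_def split: if_splits)
      moreover have "bal [c, p]"
        using w Off by (auto simp: balanced_def)
      ultimately show ?thesis using w by blast
    qed
  next
    case Idle
    then show ?thesis using assms by (auto simp: balanced_def)
  qed
qed

text \<open>Since letters emerge at the left end, the first letter of \<open>w\<close> is emitted
  last: the remaining word comes from the induction hypothesis with \<open>Grow\<close> kept, and
  \<open>g\<close> decides whether growth goes on afterwards. A partner \<open>p\<close> crosses
  \<open>u\<close>, which already consists of letters, and stops before \<open>v\<close>.\<close>

lemma derives_letters:
  assumes "bal w" "set w \<subseteq> A" "g = [nt Grow] \<or> g = [] \<and> w \<noteq> []"
  shows "(derives1 G)\<^sup>*\<^sup>* [nt Grow] (g @ letters w)"
  using assms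
proof (induction "length w" arbitrary: w g rule: less_induct)
  case less
  have IH: "(derives1 G)\<^sup>*\<^sup>* [nt Grow] ([nt Grow] @ letters w')"
    if "length w' < length w" "bal w'" "set w' \<subseteq> A" for w'
    using less.hyps[OF that(1)] that by blast
  show ?case
  proof (cases w)
    case Nil
    with less.prems show ?thesis by auto
  next
    case (Cons c w')
    from balanced_decompose[of c w'] less.prems(1) Cons
    consider "bal [c]" "bal w'" | u p v where "w' = u @ p # v" "bal [c, p]" "bal (u @ v)"
      by blast
    then show ?thesis
    proof cases
      case 1
      have "(derives1 G)\<^sup>*\<^sup>* [nt Grow] ([nt Grow] @ letters w')"
        using 1 less.prems Cons by (intro IH) auto
      also have "([nt Grow], g @ [nt (Letter c)]) \<in> prods G"
        using 1 less.prems Cons by (force simp: G_def single_rules_def)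
      then have "(derives1 G)\<^sup>*\<^sup>* ([nt Grow] @ letters w') ((g @ [nt (Letter c)]) @ letters w')"
        by (intro derives_append[OF derives_rule]) auto
      finally show ?thesis using Cons by simp
    next
      case 2
      have "(derives1 G)\<^sup>*\<^sup>* [nt Grow] ([nt Grow] @ letters (u @ v))"
        using 2 less.prems Cons by (intro IH) auto
      also have "([nt Grow], g @ [nt (Letter c), nt (Mover p)]) \<in> prods G"
        using 2 less.prems Cons by (force simp: G_def pair_rules_def)
      then have "(derives1 G)\<^sup>*\<^sup>* ([nt Grow] @ letters (u @ v))
          ((g @ [nt (Letter c), nt (Mover p)]) @ letters (u @ v))"
        by (intro derives_append[OF derives_rule]) auto
      also have "(g @ [nt (Letter c), nt (Mover p)]) @ letters (u @ v) =
          (g @ [nt (Letter c)]) @ (nt (Mover p) # letters u) @ letters v"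
        by simp
      also have "(derives1 G)\<^sup>*\<^sup>* \<dots> ((g @ [nt (Letter c)]) @ (letters u @ [nt (Letter p)]) @ letters v)"
        using 2 less.prems Cons by (intro derives_context derives_move) auto
      finally show ?thesis using Cons 2 by simp
    qed
  qed
qed

lemma derives_terminals: "set w \<subseteq> A \<Longrightarrow> (derives1 G)\<^sup>*\<^sup>* (letters w) (map Tm w)"
proof (induction w)
  case (Cons c w)
  have "([nt (Letter c)], [Tm c]) \<in> prods G"
    using Cons.prems by (auto simp: G_def final_rules_def)
  then have "(derives1 G)\<^sup>*\<^sup>* ([nt (Letter c)] @ letters w) ([Tm c] @ map Tm w)"
    using Cons by (intro derives_append[OF derives_rule]) auto
  then show ?case by simp
qed simp

lemma generated_language_G: "generated_language G = balanced_words kind A"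
proof (intro set_eqI iffI)
  fix w assume "w \<in> generated_language G"
  then have "(derives1 G)\<^sup>*\<^sup>* [nt Start] (map Tm w)"
    by (simp add: generated_language_def G_def)
  from sound[OF this] show "w \<in> balanced_words kind A"
    by (auto simp: balanced_words_def content_terminals)
next
  fix w assume "w \<in> balanced_words kind A"
  then have w: "bal w" "set w \<subseteq> A"
    by (auto simp: balanced_words_def)
  have "(derives1 G)\<^sup>*\<^sup>* [nt Start] (map Tm w)"
  proof (cases "w = []")
    case True
    have "([nt Start], []) \<in> prods G"
      by (simp add: G_def)
    with True show ?thesis
      using derives_rule by simp
  next
    case False
    have "(derives1 G)\<^sup>*\<^sup>* [nt Start] [nt Grow]"
      by (rule derives_rule) (auto simp: G_def)
    also have "(derives1 G)\<^sup>*\<^sup>* [nt Grow] (letters w)"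
      using derives_letters[OF w, of "[]"] False by simp
    also have "(derives1 G)\<^sup>*\<^sup>* (letters w) (map Tm w)"
      by (rule derives_terminals[OF w(2)])
    finally show ?thesis .
  qed
  then show "w \<in> generated_language G"
    by (simp add: generated_language_def G_def)
qed

end

lemma context_sensitive_balanced_words:
  fixes A :: "'b set"
  assumes "finite A"
  shows "context_sensitive_language (balanced_words kind A)"
proof -
  have "finite (cells A)"
    using assms by (simp add: cells_def)
  from finite_coding[OF this] obtain e :: "'b cell \<Rightarrow> nat" and d where "\<forall>x \<in> cells A. d (e x) = x"
    by blast
  then interpret balanced_grammar A kind e d
    using assms by unfold_locales auto
  show ?thesis
    using context_sensitive_G generated_language_G by (auto simp: context_sensitive_language_def)
qed


section \<open>A quadratic-time Turing machine\<close>

datatype 'a phase = Scan "'a option" | Back "'a option" | Halt bool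

text \<open>
  The argument of \<open>Scan\<close> and \<open>Back\<close> is the name of a request that is crossed off but not yet paid for.
\<close>

fun wanted :: "'a option \<Rightarrow> 'a action \<Rightarrow> bool" where
  "wanted None k \<longleftrightarrow> (\<exists>a. k = Req a)"
| "wanted (Some a) k \<longleftrightarrow> k = Off a"

fun next_debt :: "'a option \<Rightarrow> 'a action \<Rightarrow> 'a option" where
  "next_debt None (Req a) = Some a"
| "next_debt _ _ = None"

text \<open>Each search starts at the left end, so the blank met by \<open>Scan\<close> on the right
  certifies a complete search: without a debt no request is left and the word is accepted, with a
  debt no matching offer is left and it is rejected.\<close>

fun phase_step :: "('t \<Rightarrow> 'a action) \<Rightarrow> 'a phase \<Rightarrow> 't tape_sym \<Rightarrow> 'a phase \<times> 't tape_sym \<times> dir" where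
  "phase_step kind (Scan x) Blank = (Halt (x = None), Blank, Stay)"
| "phase_step kind (Scan x) (Work i) = (Scan x, Work i, Right)"
| "phase_step kind (Scan x) (Input v) =
    (if wanted x (kind v) then (Back (next_debt x (kind v)), Work 0, Left)
     else (Scan x, Input v, Right))"
| "phase_step kind (Back x) Blank = (Scan x, Blank, Right)"
| "phase_step kind (Back x) (Work i) = (Back x, Work i, Left)"
| "phase_step kind (Back x) (Input v) = (Back x, Input v, Left)"
| "phase_step kind (Halt b) s = (Halt b, s, Stay)"

definition debts :: "('t \<Rightarrow> 'a action) \<Rightarrow> 't set \<Rightarrow> 'a option set" where
  "debts kind A = insert None (Some ` {a. Req a \<in> kind ` A})"

definition phases :: "('t \<Rightarrow> 'a action) \<Rightarrow> 't set \<Rightarrow> 'a phase set" where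
  "phases kind A = Scan ` debts kind A \<union> Back ` debts kind A \<union> range Halt"

lemma phases_iff [simp]: "Scan x \<in> phases kind A \<longleftrightarrow> x \<in> debts kind A"
  "Back x \<in> phases kind A \<longleftrightarrow> x \<in> debts kind A" "Halt b \<in> phases kind A"
  by (auto simp: phases_def)

lemma finite_phases: "finite A \<Longrightarrow> finite (phases kind A)"
proof -
  assume "finite A"
  moreover have "{a. Req a \<in> kind ` A} = Req -` (kind ` A)"
    by auto
  ultimately show ?thesis
    by (simp add: phases_def debts_def finite_vimageI inj_on_def)
qed

lemma next_debt_in_debts: "v \<in> A \<Longrightarrow> next_debt x (kind v) \<in> debts kind A"
  by (cases "(x, kind v)" rule: next_debt.cases) (auto simp: debts_def image_iff, metis)

lemma phase_step_closed:
  assumes "s \<in> phases kind A" "x \<in> {Blank, Work 0} \<union> Input ` A" "phase_step kind s x = (s', y, m)"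
  shows "s' \<in> phases kind A" "y \<in> {Blank, Work 0} \<union> Input ` A"
  using assms by (cases "(kind, s, x)" rule: phase_step.cases;
      auto simp: next_debt_in_debts split: if_splits)+

locale balanced_machine =
  fixes A :: "'t set" and kind :: "'t \<Rightarrow> 'a action"
    and e :: "'a phase \<Rightarrow> nat" and d :: "nat \<Rightarrow> 'a phase"
  assumes finite_A: "finite A" and decode: "\<And>x. x \<in> phases kind A \<Longrightarrow> d (e x) = x"
begin

definition M :: "'t tm" where
  "M = \<lparr>states = e ` phases kind A, tape_alphabet = {Blank, Work 0} \<union> Input ` A,
    delta = (\<lambda>q x. case phase_step kind (d q) x of (s, y, m) \<Rightarrow> (e s, y, m)),
    initial = e (Scan None), accepting = e (Halt True), rejecting = e (Halt False)\<rparr>"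

lemma M_simps [simp]: "initial M = e (Scan None)" "accepting M = e (Halt True)" "rejecting M = e (Halt False)"
  by (auto simp: M_def)

lemma e_eq_iff: "x \<in> phases kind A \<Longrightarrow> y \<in> phases kind A \<Longrightarrow> e x = e y \<longleftrightarrow> x = y"
  by (metis decode)

lemma turing_machine_M: "turing_machine A M"
  unfolding turing_machine_def
proof (intro conjI ballI)
  fix q x assume "q \<in> states M" "x \<in> tape_alphabet M"
  then obtain s where s: "s \<in> phases kind A" "q = e s" "x \<in> {Blank, Work 0} \<union> Input ` A"
    by (auto simp: M_def)
  obtain s' y m where step: "phase_step kind s x = (s', y, m)"
    by (cases "phase_step kind s x")
  show "delta M q x \<in> states M \<times> tape_alphabet M \<times> UNIV"
    using phase_step_closed[OF s(1,3) step] s(1,2) step by (auto simp: M_def decode)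
qed (use finite_A finite_phases[OF finite_A, of kind] in
    \<open>auto simp: M_def debts_def e_eq_iff intro!: imageI\<close>)

section \<open>Invariant and running time of the machine\<close>

fun mark :: "'t tape_sym \<Rightarrow> 'a action multiset" where
  "mark (Input v) = {#kind v#}"
| "mark _ = {#}"

definition rest :: "nat \<Rightarrow> (int \<Rightarrow> 't tape_sym) \<Rightarrow> 'a action multiset" where
  "rest k T = (\<Sum>i<k. mark (T (int i)))"

lemma in_rest_iff: "c \<in># rest k T \<longleftrightarrow> (\<exists>p v. 0 \<le> p \<and> p < int k \<and> T p = Input v \<and> kind v = c)"
proof
  assume "c \<in># rest k T"
  then obtain i where "i < k" "c \<in># mark (T (int i))"
    by (auto simp: rest_def set_mset_sum)
  then show "\<exists>p v. 0 \<le> p \<and> p < int k \<and> T p = Input v \<and> kind v = c"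
    by (intro exI[of _ "int i"]) (cases "T (int i)"; auto)
next
  assume "\<exists>p v. 0 \<le> p \<and> p < int k \<and> T p = Input v \<and> kind v = c"
  then obtain p v where "0 \<le> p" "p < int k" "T p = Input v" "kind v = c"
    by blast
  then have "nat p < k" "c \<in># mark (T (int (nat p)))"
    by auto
  then show "c \<in># rest k T"
    by (auto simp: rest_def set_mset_sum intro!: bexI[of _ "nat p"])
qed

lemma rest_cross:
  assumes "0 \<le> h" "h < int k" "T h = Input v"
  shows "rest k T = add_mset (kind v) (rest k (T(h := Work 0)))"
proof -
  have h: "nat h \<in> {..<k}" "int (nat h) = h"
    using assms by auto
  have "(\<Sum>i\<in>{..<k} - {nat h}. mark ((T(h := Work 0)) (int i))) = (\<Sum>i\<in>{..<k} - {nat h}. mark (T (int i)))"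
    by (intro sum.cong) auto
  then show ?thesis
    using h assms by (simp add: rest_def sum.remove[OF _ h(1)] del: fun_upd_apply) simp
qed

lemma rest_input:
  "rest (length w) (\<lambda>p. if 0 \<le> p \<and> p < int (length w) then Input (w ! nat p) else Blank)
    = image_mset kind (mset w)"
proof -
  have "(\<Sum>i<length w. {#kind (w ! i)#}) = image_mset kind (mset w)"
    by (induction w rule: rev_induct) (auto simp: nth_append)
  then show ?thesis
    by (simp add: rest_def)
qed

text \<open>An unpaid request is added back to the balance, so crossing it off changes nothing until
  its offer is found.\<close>

fun owed :: "'a option \<Rightarrow> 'a action multiset" where
  "owed None = {#}"
| "owed (Some a) = {#Req a#}"

text \<open>Crossed-off cells hold \<open>Work 0\<close> instead of a blank, so that blanks keep
  marking the two ends of the input.\<close>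

definition tape_ok :: "nat \<Rightarrow> (int \<Rightarrow> 't tape_sym) \<Rightarrow> bool" where
  "tape_ok k T \<longleftrightarrow> (\<forall>p. 0 \<le> p \<and> p < int k \<longrightarrow> T p \<in> insert (Work 0) (Input ` A)) \<and>
    (\<forall>p. \<not> (0 \<le> p \<and> p < int k) \<longrightarrow> T p = Blank)"

text \<open>\<open>g\<close> is the fixed correct answer for the input. The bounds on the head reach
  one cell beyond the input on either side and also give the space bound.\<close>

fun phase_ok :: "nat \<Rightarrow> bool \<Rightarrow> 'a phase \<Rightarrow> int \<Rightarrow> (int \<Rightarrow> 't tape_sym) \<Rightarrow> bool" where
  "phase_ok k g (Scan x) h T \<longleftrightarrow> 0 \<le> h \<and> h \<le> int k \<and> (balanced (rest k T + owed x) \<longleftrightarrow> g) \<and>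
    (\<forall>p v. 0 \<le> p \<and> p < h \<and> T p = Input v \<longrightarrow> \<not> wanted x (kind v))"
| "phase_ok k g (Back x) h T \<longleftrightarrow> -1 \<le> h \<and> h < int k \<and> (balanced (rest k T + owed x) \<longleftrightarrow> g)"
| "phase_ok k g (Halt b) h T \<longleftrightarrow> -1 \<le> h \<and> h \<le> int k \<and> (b \<longleftrightarrow> g)"

text \<open>
  A round trip costs at most \<open>2 * k + 3\<close> steps and every turn except those at the left end uses up an input letter.
\<close>

fun potential :: "nat \<Rightarrow> 'a phase \<Rightarrow> int \<Rightarrow> (int \<Rightarrow> 't tape_sym) \<Rightarrow> nat" where
  "potential k (Scan x) h T = size (rest k T) * (2 * k + 4) + nat (int k - h) + 1"
| "potential k (Back x) h T = size (rest k T) * (2 * k + 4) + nat (h + 1) + k + 2"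
| "potential k (Halt b) h T = 0"

text \<open>A crossed-off request merely moves into the debt; a crossed-off offer cancels against
  the debt on the same name.\<close>

lemma balanced_cross:
  assumes "wanted x c"
  shows "balanced (add_mset c N + owed x) \<longleftrightarrow> balanced (N + owed (next_debt x c))"
proof (cases x)
  case None
  with assms show ?thesis by auto
next
  case (Some a)
  with assms have "c = Off a" by simp
  with Some show ?thesis
    by (auto simp: balanced_def)
qed

text \<open>The scanned part is the whole tape. If nothing is owed, no request remains and balance
  is trivial; if a request is owed, no offer remains to pay for it.\<close>

lemma scan_end:
  assumes "phase_ok k g (Scan x) (int k) T"
  shows "x = None \<longleftrightarrow> g"
proof (cases x)
  case None
  then have "Req a \<notin># rest k T" for a
    using assms by (auto simp: in_rest_iff)
  then have "balanced (rest k T)"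
    by (simp add: balanced_def not_in_iff)
  with assms None show ?thesis by simp
next
  case (Some a)
  then have "Off a \<notin># rest k T"
    using assms by (auto simp: in_rest_iff)
  then have "\<not> balanced (rest k T + owed x)"
    using Some by (auto simp: balanced_def not_in_iff intro!: exI[of _ a])
  with assms Some show ?thesis by simp
qed

lemma phase_step_ok:
  assumes ok: "tape_ok k T" "phase_ok k g s h T" and "s \<notin> range Halt"
    and step: "phase_step kind s (T h) = (s', y, m)"
  shows "tape_ok k (T(h := y)) \<and> phase_ok k g s' (move m h) (T(h := y)) \<and>
    potential k s' (move m h) (T(h := y)) < potential k s h T"
proof (cases s)
  case (Scan x)
  then have h: "0 \<le> h" "h \<le> int k"
    using ok(2) by auto
  show ?thesis
  proof (cases "T h")
    case Blank
    then have "h = int k"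
      using ok(1) h unfolding tape_ok_def by (metis image_iff insert_iff order_le_less tape_sym.distinct(1,3))
    moreover have "T(h := Blank) = T"
      using Blank by auto
    ultimately show ?thesis
      using scan_end[of k g x T] ok step Scan Blank by auto
  next
    case (Input v)
    have "h \<noteq> int k"
    proof
      assume "h = int k"
      with ok(1) have "T h = Blank"
        unfolding tape_ok_def by (metis less_irrefl)
      with Input show False by simp
    qed
    with h have h': "h < int k" by simp
    show ?thesis
    proof (cases "wanted x (kind v)")
      case True
      let ?T = "T(h := Work 0)"
      have eqs: "s' = Back (next_debt x (kind v))" "y = Work 0" "m = Left"
        using step Scan Input True by auto
      have rest: "rest k T = add_mset (kind v) (rest k ?T)"
        using rest_cross[of h k T v] h(1) h' Input by blast
      have "tape_ok k ?T"
        using ok(1) h(1) h' by (auto simp: tape_ok_def)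
      moreover have "balanced (rest k ?T + owed (next_debt x (kind v))) \<longleftrightarrow> g"
        using balanced_cross[OF True] ok(2) Scan rest by simp
      \<comment> \<open>Losing one letter lowers the potential by \<open>2 * k + 4\<close>, while
        the other terms change from \<open>k - h + 1\<close> to \<open>h + k + 2\<close>, a rise of
        only \<open>2 * h + 1\<close>.\<close>
      ultimately show ?thesis
        using eqs Scan h h' rest by auto
    next
      case False
      then have eqs: "s' = Scan x" "y = Input v" "m = Right" "T(h := y) = T"
        using step Scan Input by auto
      have "\<not> wanted x (kind u)" if "0 \<le> p" "p < h + 1" "T p = Input u" for p u
        using that False Input ok(2) Scan by (cases "p = h") (auto dest!: spec[of _ p])
      then show ?thesis
        using ok Scan h h' eqs by auto
    qed
  next
    case (Work i)
    have "h \<noteq> int k"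
    proof
      assume "h = int k"
      with ok(1) have "T h = Blank"
        unfolding tape_ok_def by (metis less_irrefl)
      with Work show False by simp
    qed
    with h have h': "h < int k" by simp
    have eqs: "s' = Scan x" "y = Work i" "m = Right" "T(h := y) = T"
      using step Scan Work by auto
    have "\<not> wanted x (kind u)" if "0 \<le> p" "p < h + 1" "T p = Input u" for p u
      using that Work ok(2) Scan by (cases "p = h") (auto dest!: spec[of _ p])
    then show ?thesis
      using ok Scan h h' eqs by auto
  qed
next
  case (Back x)
  then have h: "-1 \<le> h" "h < int k"
    using ok(2) by auto
  have blank: "T h = Blank \<longleftrightarrow> h = -1"
    using ok(1) h unfolding tape_ok_def by (auto dest!: spec[of _ h] split: if_splits)
  show ?thesis
  proof (cases "T h = Blank")
    case True
    then have "s' = Scan x" "m = Right" "T(h := y) = T"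
      using step Back by auto
    then show ?thesis
      using ok Back blank True by auto
  next
    case False
    then have "s' = Back x" "m = Left" "T(h := y) = T"
      using step Back by (cases "T h"; auto)+
    then show ?thesis
      using ok Back blank False h by auto
  qed
qed (use assms(3) in auto)

definition ok :: "nat \<Rightarrow> bool \<Rightarrow> 't config \<Rightarrow> bool" where
  "ok k g c \<longleftrightarrow> (\<exists>s \<in> phases kind A. state c = e s \<and> tape_ok k (tape c) \<and> phase_ok k g s (head c) (tape c))"

definition steps_left :: "nat \<Rightarrow> 't config \<Rightarrow> nat" where
  "steps_left k c = potential k (d (state c)) (head c) (tape c)"

lemma ok_step:
  assumes "ok k g c" "\<not> halted M c"
  shows "ok k g (tm_step M c) \<and> steps_left k (tm_step M c) < steps_left k c"
proof -
  obtain s where s: "s \<in> phases kind A" "state c = e s" "tape_ok k (tape c)"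
    "phase_ok k g s (head c) (tape c)"
    using assms(1) by (auto simp: ok_def)
  obtain s' y m where step: "phase_step kind s (tape c (head c)) = (s', y, m)"
    by (cases "phase_step kind s (tape c (head c))")
  have "s \<noteq> Halt b" for b
    using assms(2) s(2) by (cases b) (auto simp: halted_def)
  then have "s \<notin> range Halt" by auto
  note * = phase_step_ok[OF s(3,4) this step]
  have "tape c (head c) \<in> {Blank, Work 0} \<union> Input ` A"
    using s(3) unfolding tape_ok_def by (auto dest!: spec[of _ "head c"] split: if_splits)
  then have s': "s' \<in> phases kind A"
    using phase_step_closed(1)[OF s(1) _ step] by blast
  have "tm_step M c = \<lparr>state = e s', head = move m (head c), tape = (tape c)(head c := y)\<rparr>"
    using assms(2) s step by (simp add: tm_step_def M_def decode)
  then show ?thesis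
    using * s(1,2) s' by (auto simp: ok_def steps_left_def decode)
qed

lemma tm_step_halted: "halted M c \<Longrightarrow> tm_step M c = c"
  by (simp add: tm_step_def)

lemma ok_run: "ok k g c \<Longrightarrow> ok k g ((tm_step M ^^ t) c)"
proof (induction t)
  case (Suc t)
  then show ?case
    using ok_step[of k g "(tm_step M ^^ t) c"] by (cases "halted M ((tm_step M ^^ t) c)") (auto simp: tm_step_halted)
qed simp

lemma eventually_halted:
  "ok k g c \<Longrightarrow> \<exists>t \<le> steps_left k c. halted M ((tm_step M ^^ t) c)"
proof (induction "steps_left k c" arbitrary: c rule: less_induct)
  case less
  show ?case
  proof (cases "halted M c")
    case True
    then show ?thesis by (intro exI[of _ 0]) simp
  next
    case False
    then obtain t where "t \<le> steps_left k (tm_step M c)" "halted M ((tm_step M ^^ t) (tm_step M c))"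
      using less.hyps ok_step[OF less.prems] by blast
    then show ?thesis
      using ok_step[OF less.prems False] by (intro exI[of _ "Suc t"]) (auto simp del: funpow.simps simp: funpow_Suc_right)
  qed
qed

lemma ok_initial:
  assumes "w \<in> lists A"
  shows "ok (length w) (w \<in> balanced_words kind A) (initial_config M w)"
proof -
  let ?T = "\<lambda>p. if 0 \<le> p \<and> p < int (length w) then Input (w ! nat p) else Blank"
  have "tape_ok (length w) ?T"
    using assms by (auto simp: tape_ok_def in_lists_conv_set)
  moreover have "phase_ok (length w) (w \<in> balanced_words kind A) (Scan None) 0 ?T"
    using assms by (auto simp: rest_input balanced_words_def)
  ultimately show ?thesis
    by (auto simp: ok_def initial_config_def debts_def intro!: bexI[of _ "Scan None"])
qed

lemma steps_left_initial:
  "steps_left (length w) (initial_config M w) = length w * (2 * length w + 4) + length w + 1"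
  by (simp add: steps_left_def initial_config_def decode debts_def rest_input)

text \<open>Besides the input only the two adjacent blanks are visited, which gives
  \<open>k + 2\<close> cells.\<close>

lemma ok_head: "ok k g c \<Longrightarrow> head c \<in> {-1..int k}"
proof -
  assume "ok k g c"
  then obtain s where "phase_ok k g s (head c) (tape c)"
    by (auto simp: ok_def)
  then show ?thesis by (cases s) auto
qed

lemma ok_halted:
  assumes "ok k g c" "halted M c"
  shows "state c = accepting M \<longleftrightarrow> g"
proof -
  obtain s where s: "s \<in> phases kind A" "state c = e s" "phase_ok k g s (head c) (tape c)"
    using assms(1) by (auto simp: ok_def)
  then have "s = Halt True \<or> s = Halt False"
    using assms(2) by (auto simp: halted_def e_eq_iff)
  then show ?thesis
    using s by (auto simp: e_eq_iff)
qed

lemma M_decides: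
  "decides_within A M (balanced_words kind A) (\<lambda>k. k * (2 * k + 4) + k + 1) (\<lambda>k. k + 2)"
  unfolding decides_within_def
proof
  fix w assume w: "w \<in> lists A"
  let ?k = "length w" and ?g = "w \<in> balanced_words kind A"
  have ok: "ok ?k ?g (tm_run M w t)" for t
    unfolding tm_run_def by (rule ok_run[OF ok_initial[OF w]])
  obtain t where t: "t \<le> ?k * (2 * ?k + 4) + ?k + 1" "halted M (tm_run M w t)"
    using eventually_halted[OF ok_initial[OF w]] unfolding steps_left_initial tm_run_def by blast
  have "card ((\<lambda>i. head (tm_run M w i)) ` {..t}) \<le> card {-1..int ?k}"
    using ok_head[OF ok] by (intro card_mono) auto
  also have "\<dots> = ?k + 2" by simp
  finally show "\<exists>t \<le> ?k * (2 * ?k + 4) + ?k + 1. halted M (tm_run M w t) \<and>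
      (state (tm_run M w t) = accepting M \<longleftrightarrow> ?g) \<and>
      card ((\<lambda>i. head (tm_run M w i)) ` {..t}) \<le> ?k + 2"
    using t ok_halted[OF ok t(2)] by blast
qed

end

lemma balanced_words_decidable:
  fixes kind :: "'t \<Rightarrow> 'a action"
  assumes "finite A"
  shows "\<exists>M. turing_machine A M \<and>
    decides_within A M (balanced_words kind A) (\<lambda>k. k * (2 * k + 4) + k + 1) (\<lambda>k. k + 2)"
proof -
  from finite_coding[OF finite_phases[OF assms, of kind]]
  obtain e :: "'a phase \<Rightarrow> nat" and d where "\<forall>x \<in> phases kind A. d (e x) = x"
    by blast
  then interpret balanced_machine A kind e d
    using assms by unfold_locales auto
  show ?thesis
    using turing_machine_M M_decides by blast
qed

lemma quadratic_bigo: "(\<lambda>k. real (k * (2 * k + 4) + k + 1)) \<in> O(\<lambda>k. real k ^ 2)"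
proof (rule bigoI[of _ 8])
  \<comment> \<open>The bound is \<open>2 * k * k + 5 * k + 1\<close>, and 8 is the sum of its
    coefficients.\<close>
  have "k * (2 * k + 4) + k + 1 \<le> 8 * k\<^sup>2" if "k \<ge> 1" for k :: nat
  proof -
    have "k \<le> k\<^sup>2" "1 \<le> k\<^sup>2"
      using that by (auto simp: power2_eq_square)
    then show ?thesis
      unfolding power2_eq_square by (simp add: distrib_left, linarith)
  qed
  then have "real (k * (2 * k + 4) + k + 1) \<le> real (8 * k\<^sup>2)" if "k \<ge> 1" for k
    using that of_nat_le_iff by blast
  then have "norm (real (k * (2 * k + 4) + k + 1)) \<le> 8 * norm (real k ^ 2)" if "1 \<le> k" for k
    using that by fastforce
  then show "\<forall>\<^sub>F k in at_top. norm (real (k * (2 * k + 4) + k + 1)) \<le> 8 * norm (real k ^ 2)"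
    by (rule eventually_mono[OF eventually_ge_at_top[of "1 :: nat"]])
qed

lemma linear_bigo: "(\<lambda>k. real (k + 2)) \<in> O(\<lambda>k. real k)"
  by (rule bigoI[of _ 3]) (use eventually_ge_at_top[of "1 :: nat"] in \<open>auto elim!: eventually_mono\<close>)

lemma kind_of_single: "kind_of (\<alpha> # replicate m Idle) = \<alpha>"
  by (simp add: kind_of_def)

theorem theorem4p8:
  fixes R :: "'a set" and n :: nat
  assumes "finite R" and "card R \<ge> 2" and "n > 1"
  shows "context_sensitive_language (weak_agreement R n) \<and>
    \<not> context_free_language (weak_agreement R n) \<and>
    (\<exists>M T S. turing_machine (vectors R n) M \<and>
       decides_within (vectors R n) M (weak_agreement R n) T S \<and>
       (\<lambda>k. real (T k)) \<in> O(\<lambda>k. real k ^ 2) \<and>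
       (\<lambda>k. real (S k)) \<in> O(\<lambda>k. real k))"
proof (intro conjI)
  note fin = finite_vectors[OF assms(1), of n]
  show "context_sensitive_language (weak_agreement R n)"
    unfolding weak_agreement_eq by (rule context_sensitive_balanced_words[OF fin])
  obtain a b where ab: "a \<in> R" "b \<in> R" "a \<noteq> b"
    using assms(1,2) card_le_Suc0_iff_eq[of R] by fastforce
  \<comment> \<open>Padding with idle symbols realises each of the four letters of the pumping
    argument as a vector of rank \<open>n\<close>.\<close>
  define vec where "vec \<alpha> = \<alpha> # replicate (n - 1) Idle" for \<alpha> :: "'a action"
  have "vec \<alpha> \<in> vectors R n" if "\<alpha> \<in> actions R" for \<alpha>
    using that assms(3) by (auto simp: vec_def vectors_def actions_def)
  then have "{vec (Req a), vec (Req b), vec (Off a), vec (Off b)} \<subseteq> vectors R n"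
    using ab by (simp add: actions_def)
  then show "\<not> context_free_language (weak_agreement R n)"
    unfolding weak_agreement_eq
    by (rule not_context_free_balanced_words) (use ab in \<open>simp_all add: vec_def kind_of_single\<close>)
  show "\<exists>M T S. turing_machine (vectors R n) M \<and>
       decides_within (vectors R n) M (weak_agreement R n) T S \<and>
       (\<lambda>k. real (T k)) \<in> O(\<lambda>k. real k ^ 2) \<and> (\<lambda>k. real (S k)) \<in> O(\<lambda>k. real k)"
    unfolding weak_agreement_eq
    using balanced_words_decidable[OF fin, of kind_of] quadratic_bigo linear_bigo by blast
qed

end
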